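(* Let $\rho^*(\beta)=\beta-\frac12$ for $\frac12<\beta\le\frac34$ and $\rho^*(\beta)=(1-\sqrt{1-\beta})^2$ for $\frac34<\beta<1$. Let $\Omega$ be any closed set contained in the interior of the detectable region $\{(\beta,r):\rho^*(\beta)<r<1,\ \frac12<\beta<1\}$ of the $\beta$-$r$ plane. For $(\beta,r)\in\Omega$ set $\varepsilon_n=n^{-\beta}$, $\mu_n=\sqrt{2r\log n}$, and let $X_1,\dots,X_n$ be i.i.d. from $(1-\varepsilon_n)N(0,1)+\varepsilon_nN(\mu_n,1)$. Let $a_n$ be any sequence such that $a_n/\sqrt{2\log\log n}\to1$ and $P\{W_n^+\ge a_n\}\to0$ as $n\to\infty$, and let $\hat\varepsilon^*_{a_n}$ be the estimator defined in the context. Then for all $\delta>0$, $$\lim_{n\to\infty}\ \sup_{(\beta,r)\in\Omega}P\left\{\left|\frac{\hat\varepsilon^*_{a_n}}{\varepsilon_n}-1\right|\ge\delta\right\}=0.$$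
   Context: $\Phi$ is the standard normal c.d.f. and $\log$ is the natural logarithm. Definition of the estimator $\hat\varepsilon^*_{a}$ for a given $a>0$ and a sample $X_1,\dots,X_n$, $n\ge2$. Let $F_n(t)=\frac1n\#\{i:X_i\le t\}$ be the empirical c.d.f. Define $$F_a^{\pm}(t)=\frac{2F_n(t)+a^2/n\pm\frac{a}{\sqrt n}\sqrt{a^2/n+4F_n(t)-4F_n(t)^2}}{2(1+a^2/n)},$$ the two solutions $x$ of $\sqrt n\,|F_n(t)-x|=a\sqrt{x(1-x)}$. For $0\le\tau<\tau'$ and $\mu>0$ let $$D(\mu;\tau,\tau')=\frac{\Phi(\tau)-\Phi(\tau-\mu)}{\Phi(\tau')-\Phi(\tau'-\mu)},$$ which is strictly decreasing in $\mu>0$. Let $t_j=(j-1)/\sqrt{2\log n}$ for integers $1\le j\le 2\log n+1$. For each integer $1\le j\le 2\log n$, if the equation $$D(\mu;t_j,t_{j+1})=\frac{\Phi(t_j)-F_a^+(t_j)}{\Phi(t_{j+1})-F_a^-(t_{j+1})}$$ has a solution $\mu=\hat\mu^{(j)}_a>0$, set $$\hat\varepsilon^{(j)}_a=\frac{\Phi(t_j)-F_a^+(t_j)}{\Phi(t_j)-\Phi(t_j-\hat\mu^{(j)}_a)};$$ if it has no solution, set $\hat\varepsilon^{(j)}_a=0$. Finally $\hat\varepsilon^*_a=\max_{1\le j\le 2\log n}\hat\varepsilon^{(j)}_a$. Definition of $W_n^+$. For i.i.d. uniform$(0,1)$ variables $U_1,\dots,U_n$ let $V_n(t)=\frac1n\sum_{i=1}^n1_{\{U_i\le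 t\}}$ and $U_n(t)=\sqrt n\,[V_n(t)-t]$, $0<t<1$. Then $$W_n^+=\sup_{1/2\le t\le\Phi(\sqrt{2\log n})}\frac{|U_n(t)|}{\sqrt{t(1-t)}}.$$ *)

theory Defs
  imports "HOL-Probability.Probability"
begin

abbreviation Phi :: "real \<Rightarrow> real" where
  "Phi \<equiv> cdf std_normal_distribution"

text \<open>A sample of size \<open>n\<close> is a function on \<open>{1..n}\<close>; its values elsewhere play no role.\<close>

definition ecdf :: "nat \<Rightarrow> (nat \<Rightarrow> real) \<Rightarrow> real \<Rightarrow> real" where
  "ecdf n x t = real (card {i \<in> {1..n}. x i \<le> t}) / real n"

definition F_upper :: "real \<Rightarrow> nat \<Rightarrow> (nat \<Rightarrow> real) \<Rightarrow> real \<Rightarrow> real" where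
  "F_upper a n x t =
     (2 * ecdf n x t + a\<^sup>2 / n
        + a / sqrt n * sqrt (a\<^sup>2 / n + 4 * ecdf n x t - 4 * (ecdf n x t)\<^sup>2))
     / (2 * (1 + a\<^sup>2 / n))"

definition F_lower :: "real \<Rightarrow> nat \<Rightarrow> (nat \<Rightarrow> real) \<Rightarrow> real \<Rightarrow> real" where
  "F_lower a n x t =
     (2 * ecdf n x t + a\<^sup>2 / n
        - a / sqrt n * sqrt (a\<^sup>2 / n + 4 * ecdf n x t - 4 * (ecdf n x t)\<^sup>2))
     / (2 * (1 + a\<^sup>2 / n))"

definition D_ratio :: "real \<Rightarrow> real \<Rightarrow> real \<Rightarrow> real" where
  "D_ratio \<mu> \<tau> \<tau>' = (Phi \<tau> - Phi (\<tau> - \<mu>)) / (Phi \<tau>' - Phi (\<tau>' - \<mu>))"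

definition grid :: "nat \<Rightarrow> nat \<Rightarrow> real" where
  "grid n j = (real j - 1) / sqrt (2 * ln n)"

text \<open>If the denominator on the right-hand side below vanishes, the quotient is \<open>0\<close> by
  convention; since \<open>D_ratio\<close> is positive for \<open>\<mu> > 0\<close>, the equation then has no
  solution, as it should.\<close>

definition mu_equation :: "real \<Rightarrow> nat \<Rightarrow> (nat \<Rightarrow> real) \<Rightarrow> nat \<Rightarrow> real \<Rightarrow> bool" where
  "mu_equation a n x j \<mu> \<longleftrightarrow>
     D_ratio \<mu> (grid n j) (grid n (j + 1)) =
       (Phi (grid n j) - F_upper a n x (grid n j)) /
       (Phi (grid n (j + 1)) - F_lower a n x (grid n (j + 1)))"

text \<open>The description operator is justified because \<open>D_ratio\<close> is strictly decreasing in
  \<open>\<mu> > 0\<close>, so that a positive solution is unique.\<close>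

definition mu_hat :: "real \<Rightarrow> nat \<Rightarrow> (nat \<Rightarrow> real) \<Rightarrow> nat \<Rightarrow> real" where
  "mu_hat a n x j = (THE \<mu>. \<mu> > 0 \<and> mu_equation a n x j \<mu>)"

definition eps_hat :: "real \<Rightarrow> nat \<Rightarrow> (nat \<Rightarrow> real) \<Rightarrow> nat \<Rightarrow> real" where
  "eps_hat a n x j =
     (if \<exists>\<mu>>0. mu_equation a n x j \<mu>
      then (Phi (grid n j) - F_upper a n x (grid n j)) /
           (Phi (grid n j) - Phi (grid n j - mu_hat a n x j))
      else 0)"

definition eps_star :: "real \<Rightarrow> nat \<Rightarrow> (nat \<Rightarrow> real) \<Rightarrow> real" where
  "eps_star a n x = Max (eps_hat a n x ` {j. 1 \<le> j \<and> real j \<le> 2 * ln n})"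

definition W_plus :: "nat \<Rightarrow> (nat \<Rightarrow> real) \<Rightarrow> real" where
  "W_plus n u =
     (SUP t \<in> {1/2 .. Phi (sqrt (2 * ln n))}.
        \<bar>sqrt n * (ecdf n u t - t)\<bar> / sqrt (t * (1 - t)))"

definition uniform_sample :: "nat \<Rightarrow> (nat \<Rightarrow> real) measure" where
  "uniform_sample n = (\<Pi>\<^sub>M i \<in> {1..n}. uniform_measure lborel {0<..<1})"

definition normal_mixture :: "real \<Rightarrow> real \<Rightarrow> real measure" where
  "normal_mixture \<epsilon> \<mu> =
     density lborel (\<lambda>x. ennreal ((1 - \<epsilon>) * normal_density 0 1 x + \<epsilon> * normal_density \<mu> 1 x))"

definition mixture_sample :: "nat \<Rightarrow> real \<Rightarrow> real \<Rightarrow> (nat \<Rightarrow> real) measure" where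
  "mixture_sample n \<epsilon> \<mu> = (\<Pi>\<^sub>M i \<in> {1..n}. normal_mixture \<epsilon> \<mu>)"

definition eps_seq :: "real \<Rightarrow> nat \<Rightarrow> real" where
  "eps_seq \<beta> n = real n powr (- \<beta>)"

definition mu_seq :: "real \<Rightarrow> nat \<Rightarrow> real" where
  "mu_seq r n = sqrt (2 * r * ln n)"

text \<open>Only the values for \<open>1/2 < \<beta> < 1\<close> are meaningful.\<close>

definition rho_star :: "real \<Rightarrow> real" where
  "rho_star \<beta> = (if \<beta> \<le> 3/4 then \<beta> - 1/2 else (1 - sqrt (1 - \<beta>))\<^sup>2)"

definition detectable_region :: "(real \<times> real) set" where
  "detectable_region = {(\<beta>, r). rho_star \<beta> < r \<and> r < 1 \<and> 1/2 < \<beta> \<and> \<beta> < 1}"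

end

theory Submission
  imports Defs "HOL-Real_Asymp.Real_Asymp"
begin

text \<open>
  Write \<open>w(t, \<mu>) = \<Phi>(t) - \<Phi>(t - \<mu>)\<close> (the constant \<open>window\<close>), so that the distribution function of the
  sample is \<open>F = \<Phi> - \<epsilon> w(\<sqdot>, \<mu>)\<close> and \<open>D(\<mu>; t, t') = w(t, \<mu>) / w(t', \<mu>)\<close>.  Put \<open>M = sqrt (2 log n)\<close>; then
  \<open>n = exp (M\<^sup>2/2)\<close>, \<open>\<epsilon> = exp (- \<beta> M\<^sup>2/2)\<close>, \<open>\<mu> = sqrt r M\<close>, and the grid is the set of multiples of \<open>1/M\<close>
  in \<open>[0, M]\<close>.

  \<^bold>\<open>The estimator does not overshoot.\<close>  Suppose that at each grid point the standardized
  deviation of \<open>F\<^sub>n\<close> from \<open>F\<close> is at most \<open>a\<close> (a ``good'' sample).  Then \<open>F\<close> lies between \<open>F\<^sub>a\<^sup>-\<close> and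
  \<open>F\<^sub>a\<^sup>+\<close> on the grid (\<open>band_bounds\<close>), so the right-hand side of each equation is at most \<open>D(\<mu>)\<close>; as \<open>D\<close> is
  strictly decreasing, a solution is at least \<open>\<mu>\<close>, and the resulting estimate is at most \<open>\<epsilon>\<close>
  (\<open>eps_hat_le\<close>).  This is true for every \<open>j\<close>, hence for the maximum, and it remains to exhibit a
  single \<open>j\<close> for which the estimate is nearly \<open>\<epsilon>\<close>.

  \<^bold>\<open>One level suffices.\<close>  Near \<open>t = x M\<close> with \<open>x = min (2 sqrt r) 1\<close> the signal
  \<open>\<epsilon> w(t, \<mu>)\<close> is of order \<open>n\<close> to the power \<open>- \<beta> - (x - sqrt r)\<^sup>2\<close>, up to powers of \<open>M\<close>.  Detectability
  makes it larger than the width of the band by a positive power of \<open>n\<close>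
  (\<open>detectable_margins\<close>), and by compactness of \<open>\<Omega>\<close> this power is bounded below
  (\<open>uniform_margins\<close>).  So the numerator and the denominator of the equation have relative error
  \<open>\<eta>\<close> smaller than every negative power of \<open>M\<close> (\<open>noise_bound\<close>).  On the other hand, raising \<open>\<mu>\<close> by \<open>b/M\<close> lowers
  \<open>D\<close> by a factor of order \<open>1 - b\<^sup>2 / M\<^sup>4\<close> (\<open>D_ratio_drop\<close>), which outweighs \<open>\<eta>\<close>; the
  intermediate value theorem therefore puts a solution between \<open>\<mu>\<close> and \<open>\<mu> + b/M\<close>.  Over this interval
  \<open>w(t, \<sqdot>)\<close> grows at most by the factor \<open>1 + b exp (b + 2)\<close> (\<open>window_shift_le\<close>), which is as close to \<open>1\<close>
  as desired if \<open>b\<close> is small.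

  \<^bold>\<open>Samples are good with probability tending to one.\<close>  The variables \<open>F(X\<^sub>i)\<close> are independent and
  uniform, and \<open>F\<close> maps every grid point except the first into the range of the supremum
  defining \<open>W\<^sub>n\<^sup>+\<close>, so the deviations there are controlled by the assumption on \<open>a\<close>.  The first grid point
  is \<open>0\<close>, where \<open>F(0) < 1/2\<close> is outside this range; Hoeffding's inequality bounds the deviation there,
  because \<open>a\<^sub>n\<close> tends to infinity (\<open>emeasure_not_good_sample_le\<close>).
\<close>

section \<open>The standard normal distribution function\<close>

interpretation std_normal: real_distribution std_normal_distribution
  by (rule real_dist_normal_dist)

lemma Phi_diff_eq_integral:
  assumes "x \<le> y"
  shows "Phi y - Phi x = integral {x..y} std_normal_density"
proof -
  have si: "set_integrable lborel S std_normal_density" if "S \<in> sets lborel" for S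
    using that unfolding set_integrable_def by (intro integrable_mult_indicator) auto
  show "Phi y - Phi x = integral {x..y} std_normal_density"
  proof (cases "x = y")
    case False
    with assms have "x < y" by simp
    have "ennreal (measure std_normal_distribution {x<..y})
        = emeasure std_normal_distribution {x<..y}"
      by (simp add: std_normal.emeasure_eq_measure)
    also have "\<dots> = (\<integral>\<^sup>+u. ennreal (std_normal_density u * indicator {x<..y} u) \<partial>lborel)"
      by (subst emeasure_density) (auto intro!: nn_integral_cong simp: indicator_def)
    also have "\<dots> = ennreal (LINT u|lborel. std_normal_density u * indicator {x<..y} u)"
      using si[of "{x<..y}"] unfolding set_integrable_def
      by (intro nn_integral_eq_integral) (auto simp: mult.commute)
    finally have "measure std_normal_distribution {x<..y}
        = (LINT u|lborel. std_normal_density u * indicator {x<..y} u)"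
      by (subst (asm) ennreal_inj) (auto intro!: integral_nonneg_AE)
    also have "\<dots> = (LINT u:{x<..y}|lborel. std_normal_density u)"
      unfolding set_lebesgue_integral_def by (simp add: mult.commute)
    also have "\<dots> = integral {x<..y} std_normal_density"
      by (rule set_borel_integral_eq_integral(2)[OF si]) auto
    also have "\<dots> = integral {x..y} std_normal_density"
      by (rule integral_spike_set)
         (auto intro: negligible_subset[of "{x}"])
    finally show ?thesis
      using std_normal.cdf_diff_eq[OF \<open>x < y\<close>] by simp
  qed simp
qed

lemma Phi_has_derivative: "(Phi has_real_derivative std_normal_density x) (at x)"
proof -
  have "((\<lambda>u. integral {x - 1..u} std_normal_density) has_real_derivative std_normal_density x)
        (at x within {x - 1..x + 1})"
    by (rule integral_has_real_derivative)
       (auto intro!: continuous_intros simp: std_normal_density_def)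
  then have "((\<lambda>u. integral {x - 1..u} std_normal_density) has_real_derivative std_normal_density x)
        (at x)"
    by (subst (asm) at_within_interior) (auto simp: interior_atLeastAtMost_real)
  then have "((\<lambda>u. Phi (x - 1) + integral {x - 1..u} std_normal_density) has_real_derivative
      std_normal_density x) (at x)"
    by (auto intro!: derivative_eq_intros)
  moreover have "\<forall>\<^sub>F u in nhds x. Phi (x - 1) + integral {x - 1..u} std_normal_density = Phi u"
    using eventually_nhds_in_open[of "{x - 1<..}" x]
    by (auto elim!: eventually_mono simp: Phi_diff_eq_integral[symmetric])
  ultimately show ?thesis
    by (subst (asm) has_field_derivative_cong_ev[where g = Phi and y = x]) auto
qed

lemma std_normal_density_minus: "std_normal_density (- x) = std_normal_density x"
  by (simp add: std_normal_density_def)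

lemma std_normal_density_has_derivative:
  "(std_normal_density has_real_derivative - x * std_normal_density x) (at x)"
  unfolding std_normal_density_def
  by (auto intro!: derivative_eq_intros simp: real_div_sqrt divide_simps)

lemma std_normal_density_antimono:
  assumes "0 \<le> x" "x \<le> y"
  shows "std_normal_density y \<le> std_normal_density x"
  using assms unfolding std_normal_density_def
  by (auto intro!: divide_right_mono power_mono)

lemma Phi_tendsto: "(Phi \<longlongrightarrow> 1) at_top" "(Phi \<longlongrightarrow> 0) at_bot"
  using std_normal.cdf_lim_at_top_prob std_normal.cdf_lim_at_bot by auto

lemma std_normal_density_pos: "std_normal_density x > 0"
  by (rule normal_density_pos) simp

lemma Phi_strict_mono: "x < y \<Longrightarrow> Phi x < Phi y"
  by (rule DERIV_pos_imp_increasing[where f = Phi])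
     (auto intro: Phi_has_derivative std_normal_density_pos)

lemma Phi_pos: "Phi x > 0"
  using Phi_strict_mono[of "x - 1" x] std_normal.cdf_nonneg[of "x - 1"] by simp

lemma Phi_less_1: "Phi x < 1"
  using Phi_strict_mono[of x "x + 1"] std_normal.cdf_bounded_prob[of "x + 1"] by simp

lemma isCont_Phi: "isCont Phi x"
  by (rule DERIV_isCont[OF Phi_has_derivative])

lemma Phi_minus: "Phi (- x) = 1 - Phi x"
proof -
  let ?g = "\<lambda>u. Phi u + Phi (- u)"
  have "(?g has_real_derivative 0) (at u)" for u
  proof -
    have "((\<lambda>u. Phi (- u)) has_real_derivative std_normal_density (- u) * - 1) (at u)"
      by (rule DERIV_chain2[where f = Phi and g = uminus])
         (auto intro!: Phi_has_derivative derivative_eq_intros)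
    from DERIV_add[OF Phi_has_derivative[of u] this] show ?thesis
      by (simp add: std_normal_density_minus)
  qed
  then have "?g u = ?g x" for u
    by (intro DERIV_isconst_all) auto
  then have "(\<lambda>_. ?g x) = ?g"
    by (intro ext) (rule sym)
  moreover have "(?g \<longlongrightarrow> 1 + 0) at_top"
    by (intro tendsto_intros Phi_tendsto(1) filterlim_compose[OF Phi_tendsto(2)]
        filterlim_uminus_at_bot_at_top)
  ultimately have "((\<lambda>_. ?g x) \<longlongrightarrow> 1 + 0) (at_top :: real filter)"
    by simp
  then have "?g x = 1 + 0"
    by (rule tendsto_unique[rotated 2]) auto
  then show ?thesis by simp
qed

lemma Phi_0: "Phi 0 = 1 / 2"
  using Phi_minus[of 0] by simp

text \<open>
  The function \<open>1 - \<Phi> - \<phi>\<close> has derivative \<open>(u - 1) \<phi>(u)\<close>, so on \<open>[1, \<infinity>)\<close> it increases to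
  its limit \<open>0\<close>.
\<close>

lemma Phi_tail_le:
  assumes "t \<ge> 1"
  shows "1 - Phi t \<le> std_normal_density t"
proof -
  let ?g = "\<lambda>u. 1 - Phi u - std_normal_density u"
  have d: "(?g has_real_derivative (u - 1) * std_normal_density u) (at u)" for u
    by (rule derivative_eq_intros Phi_has_derivative std_normal_density_has_derivative refl)+
       (simp add: algebra_simps)
  have "?g t \<le> ?g u" if "t \<le> u" for u
    by (rule DERIV_nonneg_imp_nondecreasing[where f = ?g, OF that])
       (use assms d in \<open>auto intro!: exI[of _ "(_ - 1) * std_normal_density _"]\<close>)
  then have "\<forall>\<^sub>F u in at_top. ?g t \<le> ?g u"
    by (intro eventually_mono[OF eventually_ge_at_top[of t]])
  moreover have "(std_normal_density \<longlongrightarrow> 0) at_top"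
    unfolding std_normal_density_def by real_asymp
  then have "(?g \<longlongrightarrow> 1 - 1 - 0) at_top"
    by (intro tendsto_intros Phi_tendsto(1))
  ultimately have "?g t \<le> 1 - 1 - 0"
    by (intro tendsto_lowerbound[where F = at_top]) auto
  then show ?thesis by simp
qed

lemma Phi_diff_bounds:
  assumes "0 \<le> x" "x \<le> y"
  shows "Phi y - Phi x \<le> (y - x) * std_normal_density x"
    and "(y - x) * std_normal_density y \<le> Phi y - Phi x"
proof -
  have "\<exists>z. x \<le> z \<and> z \<le> y \<and> Phi y - Phi x = (y - x) * std_normal_density z"
  proof (cases "x = y")
    case False
    then have "x < y" using assms by simp
    then obtain z where "x < z" "z < y" "Phi y - Phi x = (y - x) * std_normal_density z"
      using MVT2[of x y Phi std_normal_density] Phi_has_derivative by blast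
    then show ?thesis by (intro exI[of _ z]) auto
  qed auto
  then obtain z where z: "x \<le> z" "z \<le> y" "Phi y - Phi x = (y - x) * std_normal_density z"
    by blast
  then show "Phi y - Phi x \<le> (y - x) * std_normal_density x"
       "(y - x) * std_normal_density y \<le> Phi y - Phi x"
    using assms by (auto intro!: mult_left_mono std_normal_density_antimono)
qed

section \<open>Monotonicity of the ratio of window probabilities\<close>

definition window :: "real \<Rightarrow> real \<Rightarrow> real" where
  "window \<tau> \<mu> = Phi \<tau> - Phi (\<tau> - \<mu>)"

lemma D_ratio_window: "D_ratio \<mu> \<tau> \<tau>' = window \<tau> \<mu> / window \<tau>' \<mu>"
  by (simp add: D_ratio_def window_def)

lemma window_strict_mono: "\<mu> < \<nu> \<Longrightarrow> window \<tau> \<mu> < window \<tau> \<nu>"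
  unfolding window_def using Phi_strict_mono[of "\<tau> - \<nu>" "\<tau> - \<mu>"] by simp

lemma window_0: "window \<tau> 0 = 0"
  by (simp add: window_def)

lemma window_pos: "0 < \<mu> \<Longrightarrow> 0 < window \<tau> \<mu>"
  using window_strict_mono[of 0 \<mu>] by (simp add: window_0)

lemma window_has_derivative:
  "(window \<tau> has_real_derivative std_normal_density (\<tau> - \<mu>)) (at \<mu>)"
proof -
  have "((\<lambda>\<mu>. Phi (\<tau> - \<mu>)) has_real_derivative std_normal_density (\<tau> - \<mu>) * - 1) (at \<mu>)"
    by (rule DERIV_chain2[where f = Phi and g = "\<lambda>\<mu>. \<tau> - \<mu>"])
       (auto intro!: Phi_has_derivative derivative_eq_intros)
  from DERIV_diff[OF DERIV_const[of "Phi \<tau>"] this] show ?thesis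
    unfolding window_def[abs_def] by simp
qed

lemma isCont_window: "isCont (window \<tau>) \<mu>"
  by (rule DERIV_isCont[OF window_has_derivative])

text \<open>
  The likelihood ratio \<open>\<phi>(\<tau> - \<xi>) / \<phi>(\<tau>' - \<xi>)\<close>; in this form its monotonicity in \<open>\<xi>\<close> is evident.
\<close>

definition density_ratio :: "real \<Rightarrow> real \<Rightarrow> real \<Rightarrow> real" where
  "density_ratio \<tau> \<tau>' \<xi> = exp ((\<tau>' - \<tau>) * (\<tau>' + \<tau> - 2 * \<xi>) / 2)"

lemma std_normal_density_ratio:
  "std_normal_density (\<tau> - \<xi>) = density_ratio \<tau> \<tau>' \<xi> * std_normal_density (\<tau>' - \<xi>)"
proof -
  have "- ((\<tau> - \<xi>)\<^sup>2) / 2 = (\<tau>' - \<tau>) * (\<tau>' + \<tau> - 2 * \<xi>) / 2 + (- ((\<tau>' - \<xi>)\<^sup>2) / 2)"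
    by (simp add: power2_eq_square field_simps)
  then show ?thesis
    unfolding std_normal_density_def density_ratio_def by (simp add: exp_add [symmetric])
qed

lemma density_ratio_shift:
  "density_ratio \<tau> \<tau>' (\<xi> + s) = density_ratio \<tau> \<tau>' \<xi> * exp (- ((\<tau>' - \<tau>) * s))"
  unfolding density_ratio_def exp_add [symmetric] by (simp add: field_simps)

lemma density_ratio_antimono:
  assumes "\<tau> < \<tau>'" "\<xi> < \<xi>'"
  shows "density_ratio \<tau> \<tau>' \<xi>' < density_ratio \<tau> \<tau>' \<xi>"
  using assms by (simp add: density_ratio_def)

text \<open>
  Cauchy's mean value theorem: on every interval of means the two windows grow in the proportion
  given by the likelihood ratio at an intermediate mean.
\<close>

lemma window_increment_ratio:
  assumes "\<mu> < \<nu>"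
  obtains \<xi> where "\<mu> < \<xi>" "\<xi> < \<nu>"
    "window \<tau> \<nu> - window \<tau> \<mu> = density_ratio \<tau> \<tau>' \<xi> * (window \<tau>' \<nu> - window \<tau>' \<mu>)"
proof -
  obtain \<xi> where \<xi>: "\<mu> < \<xi>" "\<xi> < \<nu>"
    "(window \<tau> \<nu> - window \<tau> \<mu>) * std_normal_density (\<tau>' - \<xi>)
      = (window \<tau>' \<nu> - window \<tau>' \<mu>) * std_normal_density (\<tau> - \<xi>)"
    using GMVT'[of \<mu> \<nu> "window \<tau>" "window \<tau>'" "\<lambda>\<xi>. std_normal_density (\<tau>' - \<xi>)"
        "\<lambda>\<xi>. std_normal_density (\<tau> - \<xi>)"]
      assms window_has_derivative isCont_window by blast
  then have "std_normal_density (\<tau>' - \<xi>) * (window \<tau> \<nu> - window \<tau> \<mu>)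
      = std_normal_density (\<tau>' - \<xi>) * (density_ratio \<tau> \<tau>' \<xi> * (window \<tau>' \<nu> - window \<tau>' \<mu>))"
    using std_normal_density_ratio[of \<tau> \<xi> \<tau>'] by (simp add: mult_ac)
  then have "window \<tau> \<nu> - window \<tau> \<mu> = density_ratio \<tau> \<tau>' \<xi> * (window \<tau>' \<nu> - window \<tau>' \<mu>)"
    using std_normal_density_pos[of "\<tau>' - \<xi>"] by (metis less_irrefl mult_left_cancel)
  with \<xi> that show ?thesis by blast
qed

text \<open>
  \<open>D(\<mu> + h)\<close> is a weighted average of the likelihood ratios at intermediate points of \<open>[0, \<mu>]\<close>,
  \<open>[\<mu>, \<mu> + h/2]\<close> and \<open>[\<mu> + h/2, \<mu> + h]\<close>, the weights being the increments of \<open>w(\<tau>', \<sqdot>)\<close>, and the first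
  of these ratios is \<open>D(\<mu>)\<close>.  The likelihood ratio decreases, and the last interval is separated from
  the first one by \<open>h/2\<close>, so its ratio is smaller by an explicit factor.  Halving the
  step is what turns monotonicity into a quantitative drop.
\<close>

lemma D_ratio_shift_le:
  assumes "\<tau> < \<tau>'" "0 < \<mu>" "0 < h"
  shows "D_ratio (\<mu> + h) \<tau> \<tau>' \<le> D_ratio \<mu> \<tau> \<tau>' *
    (1 - (1 - exp (- ((\<tau>' - \<tau>) * (h / 2)))) *
         ((window \<tau>' (\<mu> + h) - window \<tau>' (\<mu> + h / 2)) / window \<tau>' (\<mu> + h)))"
proof -
  let ?A = "window \<tau>" and ?B = "window \<tau>'" and ?\<rho> = "density_ratio \<tau> \<tau>'"
  obtain \<xi>1 where 1: "0 < \<xi>1" "\<xi>1 < \<mu>" "?A \<mu> - ?A 0 = ?\<rho> \<xi>1 * (?B \<mu> - ?B 0)"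
    using window_increment_ratio[OF assms(2), of \<tau> \<tau>'] by blast
  have "\<mu> < \<mu> + h / 2" "\<mu> + h / 2 < \<mu> + h" using assms by auto
  obtain \<xi>2 where 2: "\<mu> < \<xi>2" "?A (\<mu> + h / 2) - ?A \<mu> = ?\<rho> \<xi>2 * (?B (\<mu> + h / 2) - ?B \<mu>)"
    using window_increment_ratio[OF \<open>\<mu> < \<mu> + h / 2\<close>, of \<tau> \<tau>'] by blast
  obtain \<xi>3 where 3: "\<mu> + h / 2 < \<xi>3"
      "?A (\<mu> + h) - ?A (\<mu> + h / 2) = ?\<rho> \<xi>3 * (?B (\<mu> + h) - ?B (\<mu> + h / 2))"
    using window_increment_ratio[OF \<open>\<mu> + h / 2 < \<mu> + h\<close>, of \<tau> \<tau>'] by blast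
  define e where "e = exp (- ((\<tau>' - \<tau>) * (h / 2)))"
  have B: "0 < ?B \<mu>" "?B \<mu> < ?B (\<mu> + h / 2)" "?B (\<mu> + h / 2) < ?B (\<mu> + h)"
    using assms by (auto intro!: window_pos window_strict_mono)
  have r2: "?\<rho> \<xi>2 \<le> ?\<rho> \<xi>1"
    using density_ratio_antimono[OF assms(1), of \<xi>1 \<xi>2] 1 2 by simp
  have "?\<rho> \<xi>3 \<le> ?\<rho> (\<xi>1 + h / 2)"
    using density_ratio_antimono[OF assms(1), of "\<xi>1 + h / 2" \<xi>3] 1 3 by simp
  then have r3: "?\<rho> \<xi>3 \<le> ?\<rho> \<xi>1 * e"
    by (simp add: density_ratio_shift e_def)
  have A1: "?A \<mu> = ?\<rho> \<xi>1 * ?B \<mu>"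
    using 1 by (simp add: window_0)
  have D1: "D_ratio \<mu> \<tau> \<tau>' = ?\<rho> \<xi>1"
    using A1 B by (simp add: D_ratio_window)
  have "?A (\<mu> + h) = ?A \<mu> + (?A (\<mu> + h / 2) - ?A \<mu>) + (?A (\<mu> + h) - ?A (\<mu> + h / 2))"
    by simp
  also have "\<dots> \<le> ?\<rho> \<xi>1 * ?B \<mu> + ?\<rho> \<xi>1 * (?B (\<mu> + h / 2) - ?B \<mu>)
      + ?\<rho> \<xi>1 * e * (?B (\<mu> + h) - ?B (\<mu> + h / 2))"
    unfolding 2(2) 3(2) using B r2 r3 A1 by (intro add_mono mult_right_mono) auto
  also have "\<dots> = ?\<rho> \<xi>1 * (?B (\<mu> + h) - (1 - e) * (?B (\<mu> + h) - ?B (\<mu> + h / 2)))"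
    by (simp add: algebra_simps)
  finally have "D_ratio (\<mu> + h) \<tau> \<tau>'
      \<le> ?\<rho> \<xi>1 * (?B (\<mu> + h) - (1 - e) * (?B (\<mu> + h) - ?B (\<mu> + h / 2))) / ?B (\<mu> + h)"
    unfolding D_ratio_window using B by (intro divide_right_mono) auto
  also have "\<dots> = ?\<rho> \<xi>1 * (1 - (1 - e) * ((?B (\<mu> + h) - ?B (\<mu> + h / 2)) / ?B (\<mu> + h)))"
    using B by (simp add: field_simps)
  finally show ?thesis
    unfolding D1 e_def .
qed

lemma D_ratio_pos: "0 < \<mu> \<Longrightarrow> 0 < D_ratio \<mu> \<tau> \<tau>'"
  by (simp add: D_ratio_window window_pos)

lemma D_ratio_strict_antimono:
  assumes "\<tau> < \<tau>'" "0 < \<mu>" "\<mu> < \<nu>"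
  shows "D_ratio \<nu> \<tau> \<tau>' < D_ratio \<mu> \<tau> \<tau>'"
proof -
  define h where "h = \<nu> - \<mu>"
  have h: "0 < h" "\<nu> = \<mu> + h" using assms by (auto simp: h_def)
  have "0 < (1 - exp (- ((\<tau>' - \<tau>) * (h / 2)))) *
         ((window \<tau>' (\<mu> + h) - window \<tau>' (\<mu> + h / 2)) / window \<tau>' (\<mu> + h))"
    using assms h by (intro mult_pos_pos divide_pos_pos)
      (auto intro!: window_pos window_strict_mono)
  then have "D_ratio \<mu> \<tau> \<tau>' *
    (1 - (1 - exp (- ((\<tau>' - \<tau>) * (h / 2)))) *
         ((window \<tau>' (\<mu> + h) - window \<tau>' (\<mu> + h / 2)) / window \<tau>' (\<mu> + h))) < D_ratio \<mu> \<tau> \<tau>' * 1"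
    using D_ratio_pos[OF assms(2)] by (intro mult_strict_left_mono) auto
  with D_ratio_shift_le[OF assms(1,2) h(1)] show ?thesis
    by (simp add: h)
qed

lemma isCont_D_ratio: "0 < \<mu> \<Longrightarrow> isCont (\<lambda>\<mu>. D_ratio \<mu> \<tau> \<tau>') \<mu>"
  unfolding D_ratio_window using window_pos[of \<mu> \<tau>']
  by (intro continuous_intros isCont_window) auto

text \<open>
  Lowering the argument of the normal density by \<open>h\<close> raises it at most by the factor \<open>exp (h y)\<close>.  Since
  all arguments below are at most \<open>M\<close>, shifts of order \<open>1/M\<close> cost only bounded factors; this takes the
  place of tail asymptotics.
\<close>

lemma std_normal_density_shift_le:
  assumes "0 \<le> h"
  shows "std_normal_density (y - h) \<le> exp (h * y) * std_normal_density y"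
proof -
  have "- ((y - h)\<^sup>2) / 2 \<le> h * y + - (y\<^sup>2) / 2"
    by (simp add: power2_eq_square field_simps)
  then have "exp (- ((y - h)\<^sup>2) / 2) \<le> exp (h * y) * exp (- (y\<^sup>2) / 2)"
    by (simp only: exp_add [symmetric] exp_le_cancel_iff)
  then show ?thesis
    unfolding std_normal_density_def by (simp add: divide_right_mono)
qed

lemma window_increment_bounds:
  assumes "\<nu> \<le> \<tau>" "\<mu> \<le> \<nu>"
  shows "window \<tau> \<nu> - window \<tau> \<mu> \<le> (\<nu> - \<mu>) * std_normal_density (\<tau> - \<nu>)"
    and "(\<nu> - \<mu>) * std_normal_density (\<tau> - \<mu>) \<le> window \<tau> \<nu> - window \<tau> \<mu>"
  using Phi_diff_bounds[of "\<tau> - \<nu>" "\<tau> - \<mu>"] assms by (auto simp: window_def)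

text \<open>
  The part of the window that is adjacent to its lower end \<open>\<tau> - \<mu>\<close> and has length \<open>1/M\<close> is
  enough for this bound.
\<close>

lemma window_ge:
  assumes "1 \<le> M" "\<tau> \<le> M" "1 / M \<le> \<mu>" "\<mu> \<le> \<tau>"
  shows "exp (- 2) * std_normal_density (\<tau> - \<mu>) / M \<le> window \<tau> \<mu>"
proof -
  have "0 < 1 / M" "1 / M \<le> 1" using assms by auto
  moreover from this have "\<tau> - \<mu> + 1 / M \<le> M + 1 / M"
    using assms by linarith
  ultimately have "1 / M * (\<tau> - \<mu> + 1 / M) \<le> 1 / M * (M + 1 / M)"
    by (intro mult_left_mono) auto
  also have "\<dots> = 1 + 1 / M * (1 / M)"
    using assms by (simp add: field_simps)
  also have "\<dots> \<le> 1 + 1 * 1"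
    using \<open>1 / M \<le> 1\<close> \<open>0 < 1 / M\<close> by (intro add_left_mono mult_mono) auto
  finally have le2: "1 / M * (\<tau> - \<mu> + 1 / M) \<le> 2" by simp
  have "std_normal_density (\<tau> - \<mu>) \<le> exp (1 / M * (\<tau> - \<mu> + 1 / M)) * std_normal_density (\<tau> - \<mu> + 1 / M)"
    using std_normal_density_shift_le[of "1 / M" "\<tau> - \<mu> + 1 / M"] \<open>0 < 1 / M\<close> by simp
  also have "\<dots> \<le> exp 2 * std_normal_density (\<tau> - \<mu> + 1 / M)"
    using le2 by (intro mult_right_mono) auto
  finally have "exp (- 2) * std_normal_density (\<tau> - \<mu>) \<le> std_normal_density (\<tau> - (\<mu> - 1 / M))"
    by (simp add: exp_minus field_simps)
  then have "exp (- 2) * std_normal_density (\<tau> - \<mu>) / M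
      \<le> (\<mu> - (\<mu> - 1 / M)) * std_normal_density (\<tau> - (\<mu> - 1 / M))"
    using assms by (simp add: divide_right_mono)
  also have "\<dots> \<le> window \<tau> \<mu> - window \<tau> (\<mu> - 1 / M)"
    using window_increment_bounds(2)[of \<mu> \<tau> "\<mu> - 1 / M"] assms \<open>0 < 1 / M\<close> by simp
  also have "\<dots> \<le> window \<tau> \<mu>"
    using window_pos[of "\<mu> - 1 / M" \<tau>] assms(3) by (cases "\<mu> = 1 / M") (auto simp: window_0)
  finally show ?thesis .
qed

text \<open>
  The increment of \<open>w(\<tau>, \<sqdot>)\<close> over a step \<open>c/M\<close> is compared with \<open>w(\<tau>, \<mu>)\<close> itself, which by
  \<open>window_ge\<close> is not smaller than \<open>\<phi>(\<tau> - \<mu>) / M\<close> up to a constant.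
\<close>

lemma window_shift_le:
  assumes "1 \<le> M" "\<tau> \<le> M" "1 / M \<le> \<mu>" "0 < c" "\<mu> + c / M \<le> \<tau>"
  shows "window \<tau> (\<mu> + c / M) \<le> (1 + c * exp (c + 2)) * window \<tau> \<mu>"
proof -
  have "0 < M" "0 < \<mu>" using assms by (auto intro: less_le_trans[of 0 "1 / M"])
  have "0 \<le> c / M" "0 < c / M" using assms by auto
  have "window \<tau> (\<mu> + c / M) - window \<tau> \<mu> \<le> c / M * std_normal_density (\<tau> - \<mu> - c / M)"
    using window_increment_bounds(1)[of "\<mu> + c / M" \<tau> \<mu>] assms \<open>0 \<le> c / M\<close>
    by (simp add: diff_diff_eq)
  also have "\<dots> \<le> c / M * (exp (c / M * (\<tau> - \<mu>)) * std_normal_density (\<tau> - \<mu>))"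
    using std_normal_density_shift_le[OF \<open>0 \<le> c / M\<close>, of "\<tau> - \<mu>"] \<open>0 \<le> c / M\<close>
    by (intro mult_left_mono) auto
  also have "c / M * (\<tau> - \<mu>) \<le> c / M * M"
    using assms \<open>0 < \<mu>\<close> \<open>0 \<le> c / M\<close> by (intro mult_left_mono) auto
  then have "c / M * (exp (c / M * (\<tau> - \<mu>)) * std_normal_density (\<tau> - \<mu>))
      \<le> c / M * (exp c * std_normal_density (\<tau> - \<mu>))"
    using \<open>0 < M\<close> \<open>0 \<le> c / M\<close> by (intro mult_left_mono mult_right_mono) auto
  also have "\<dots> = c * exp (c + 2) * (exp (- 2) * std_normal_density (\<tau> - \<mu>) / M)"
    by (simp add: exp_add exp_minus)
  also have "\<dots> \<le> c * exp (c + 2) * window \<tau> \<mu>"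
    using window_ge[of M \<tau> \<mu>] assms \<open>0 < c / M\<close> by (intro mult_left_mono) auto
  finally show ?thesis by (simp add: algebra_simps)
qed

text \<open>
  On the grid neighbouring levels differ by \<open>1/M\<close>.  A step \<open>c/M\<close> of the mean then lowers \<open>D\<close> by a
  relative amount of order \<open>c\<^sup>2/M\<^sup>4\<close>: in \<open>D_ratio_shift_le\<close> one factor \<open>c/M\<^sup>2\<close> is the change of the likelihood
  ratio, another is the share of the last half step in the whole window.
\<close>

lemma D_ratio_drop:
  assumes "1 \<le> M" "\<tau>' \<le> M" "\<tau>' = \<tau> + 1 / M" "0 < \<mu>" "\<mu> \<le> M" "0 < c" "c \<le> 1" "\<mu> + c / M \<le> \<tau>'"
  shows "D_ratio (\<mu> + c / M) \<tau> \<tau>' \<le>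
    D_ratio \<mu> \<tau> \<tau>' * (1 - (1 - exp (- (c / (2 * M\<^sup>2)))) * (c * exp (- c) / (4 * M\<^sup>2)))"
proof -
  define h where "h = c / M"
  have "0 < M" using assms by simp
  have "c * 1 \<le> M * M" using assms by (intro mult_mono) auto
  then have h: "0 < h" "h \<le> M" "h * M = c"
    using assms \<open>0 < M\<close> by (auto simp: h_def pos_divide_le_eq)
  have "\<tau> < \<tau>'" using assms by simp
  let ?B = "window \<tau>'" and ?f = "std_normal_density (\<tau>' - (\<mu> + h))"
  have "?f \<le> exp (h / 2 * (\<tau>' - (\<mu> + h / 2))) * std_normal_density (\<tau>' - (\<mu> + h / 2))"
    using std_normal_density_shift_le[of "h / 2" "\<tau>' - (\<mu> + h / 2)"] h
    by (simp add: algebra_simps)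
  also have "\<dots> \<le> exp c * std_normal_density (\<tau>' - (\<mu> + h / 2))"
  proof -
    have "h / 2 * (\<tau>' - (\<mu> + h / 2)) \<le> h * M"
      using assms h by (intro mult_mono) auto
    then show ?thesis using h by (intro mult_right_mono) auto
  qed
  finally have "exp (- c) * ?f \<le> std_normal_density (\<tau>' - (\<mu> + h / 2))"
    by (simp add: exp_minus field_simps)
  then have "h / 2 * (exp (- c) * ?f) \<le> h / 2 * std_normal_density (\<tau>' - (\<mu> + h / 2))"
    using h by (intro mult_left_mono) auto
  also have "\<dots> \<le> ?B (\<mu> + h) - ?B (\<mu> + h / 2)"
    using window_increment_bounds(2)[of "\<mu> + h" \<tau>' "\<mu> + h / 2"] assms(8) h(1)
    unfolding h_def [symmetric] by simp
  finally have num: "h / 2 * (exp (- c) * ?f) \<le> ?B (\<mu> + h) - ?B (\<mu> + h / 2)" .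
  have "?B (\<mu> + h) \<le> (\<mu> + h) * ?f"
    using window_increment_bounds(1)[of "\<mu> + h" \<tau>' 0] assms h by (simp add: window_0 h_def)
  also have "\<dots> \<le> (2 * M) * ?f"
    using assms h by (intro mult_right_mono) auto
  finally have den: "?B (\<mu> + h) \<le> (2 * M) * ?f" .
  have "0 < ?B (\<mu> + h)" using assms h by (intro window_pos) auto
  have "c * exp (- c) / (4 * M\<^sup>2) = (h / 2 * (exp (- c) * ?f)) / ((2 * M) * ?f)"
    using \<open>0 < M\<close> std_normal_density_pos[of "\<tau>' - (\<mu> + h)"]
    by (simp add: h_def power2_eq_square)
  also have "\<dots> \<le> (?B (\<mu> + h) - ?B (\<mu> + h / 2)) / ?B (\<mu> + h)"
    using num den \<open>0 < ?B (\<mu> + h)\<close> h window_strict_mono[of "\<mu> + h / 2" "\<mu> + h" \<tau>']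
    by (intro frac_le) auto
  finally have ratio: "c * exp (- c) / (4 * M\<^sup>2) \<le> \<dots>" .
  have e: "(\<tau>' - \<tau>) * (h / 2) = c / (2 * M\<^sup>2)"
    using assms by (simp add: h_def power2_eq_square)
  have "D_ratio (\<mu> + h) \<tau> \<tau>' \<le> D_ratio \<mu> \<tau> \<tau>' *
    (1 - (1 - exp (- (c / (2 * M\<^sup>2)))) * ((?B (\<mu> + h) - ?B (\<mu> + h / 2)) / ?B (\<mu> + h)))"
    using D_ratio_shift_le[OF \<open>\<tau> < \<tau>'\<close> assms(4) h(1)] unfolding e .
  also have "\<dots> \<le> D_ratio \<mu> \<tau> \<tau>' *
    (1 - (1 - exp (- (c / (2 * M\<^sup>2)))) * (c * exp (- c) / (4 * M\<^sup>2)))"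
    using D_ratio_pos[OF assms(4), of \<tau> \<tau>'] ratio assms
    by (intro mult_left_mono diff_left_mono) auto
  finally show ?thesis by (simp add: h_def)
qed

section \<open>The distribution function of the mixture\<close>

lemma window_le_Phi: "window \<tau> \<mu> \<le> Phi \<tau>"
  using Phi_pos[of "\<tau> - \<mu>"] by (simp add: window_def)

definition mixture_cdf :: "real \<Rightarrow> real \<Rightarrow> real \<Rightarrow> real" where
  "mixture_cdf \<epsilon> \<mu> t = Phi t - \<epsilon> * window t \<mu>"

lemma mixture_cdf_convex: "mixture_cdf \<epsilon> \<mu> t = (1 - \<epsilon>) * Phi t + \<epsilon> * Phi (t - \<mu>)"
  by (simp add: mixture_cdf_def window_def algebra_simps)

lemma mixture_cdf_mem:
  assumes "0 \<le> \<epsilon>" "\<epsilon> \<le> 1"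
  shows "0 \<le> mixture_cdf \<epsilon> \<mu> t" "mixture_cdf \<epsilon> \<mu> t \<le> 1"
proof -
  show "0 \<le> mixture_cdf \<epsilon> \<mu> t"
    unfolding mixture_cdf_convex using assms Phi_pos[of t] Phi_pos[of "t - \<mu>"] by simp
  show "mixture_cdf \<epsilon> \<mu> t \<le> 1"
    unfolding mixture_cdf_convex
    using assms Phi_less_1[of t] Phi_less_1[of "t - \<mu>"] by (intro convex_bound_le) auto
qed

lemma mixture_cdf_strict_mono:
  assumes "0 \<le> \<epsilon>" "\<epsilon> < 1" "s < t"
  shows "mixture_cdf \<epsilon> \<mu> s < mixture_cdf \<epsilon> \<mu> t"
  unfolding mixture_cdf_convex
  using assms Phi_strict_mono[of s t] Phi_strict_mono[of "s - \<mu>" "t - \<mu>"]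
  by (intro add_less_le_mono mult_strict_left_mono mult_left_mono) auto

lemma isCont_mixture_cdf: "isCont (mixture_cdf \<epsilon> \<mu>) t"
proof -
  have "isCont (\<lambda>t. Phi (t - \<mu>)) t"
    by (rule isCont_o2[where g = Phi and f = "\<lambda>t. t - \<mu>"]) (auto intro: isCont_Phi)
  then have "isCont (\<lambda>t. (1 - \<epsilon>) * Phi t + \<epsilon> * Phi (t - \<mu>)) t"
    by (intro isCont_add isCont_mult isCont_Phi continuous_const)
  then show ?thesis
    unfolding mixture_cdf_convex[abs_def] .
qed

section \<open>The confidence band\<close>

lemma ecdf_nonneg: "0 \<le> ecdf n x t"
  by (simp add: ecdf_def)

lemma ecdf_le_1: "ecdf n x t \<le> 1"
proof -
  have "card {i \<in> {1..n}. x i \<le> t} \<le> card {1..n}"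
    by (intro card_mono) auto
  then show ?thesis by (cases "n = 0") (auto simp: ecdf_def divide_le_eq)
qed

text \<open>
  The band consists of the \<open>v\<close> with \<open>(p - v)\<^sup>2 \<le> b v (1 - v)\<close>, where \<open>p\<close> is the value of the empirical
  distribution function and \<open>b = a\<^sup>2/n\<close>; this is a quadratic inequality whose two roots are \<open>F\<^sub>a\<^sup>-\<close> and
  \<open>F\<^sub>a\<^sup>+\<close>.  Hence \<open>F\<close> lies between the roots.  The width is estimated through \<open>p\<close>: at the roots and at
  \<open>F\<close> the distance to \<open>p\<close> is at most \<open>sqrt (b (1 - v))\<close>.  Bounding by \<open>1 - v\<close> instead of
  \<open>v (1 - v)\<close> loses nothing in the upper tail, where the bounds are needed.
\<close>

lemma band_bounds:
  fixes a F :: real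
  assumes "0 < n" "0 < a" "0 \<le> F" "F \<le> 1"
    and dev: "\<bar>sqrt n * (ecdf n x t - F)\<bar> \<le> a * sqrt (F * (1 - F))"
  shows "F \<le> F_upper a n x t" and "F_lower a n x t \<le> F"
    and "F_upper a n x t - F \<le> 2 * (a / sqrt n) * sqrt (1 - F)"
    and "F - F_lower a n x t \<le> a / sqrt n * (2 * sqrt (1 - F) + a / sqrt n)"
proof -
  define p where "p = ecdf n x t"
  define c where "c = a / sqrt n"
  define b where "b = c\<^sup>2"
  define s where "s = c * sqrt (b + 4 * p - 4 * p\<^sup>2)"
  define U where "U = F_upper a n x t"
  define L where "L = F_lower a n x t"
  have c: "0 < c" using assms by (simp add: c_def)
  have b: "a\<^sup>2 / n = b" "0 < b" using assms c by (auto simp: b_def c_def power_divide)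
  have p: "0 \<le> p" "p \<le> 1" by (auto simp: p_def ecdf_nonneg ecdf_le_1)
  have pp: "0 \<le> p - p\<^sup>2" using p by (simp add: power2_eq_square mult_left_le)
  have s0: "0 \<le> s" using c b pp by (auto simp: s_def)
  have s2: "s\<^sup>2 = (2 * p + b)\<^sup>2 - 4 * (1 + b) * p\<^sup>2"
    using b pp by (simp add: s_def power_mult_distrib b_def [symmetric])
      (simp add: power2_eq_square algebra_simps)
  have U: "2 * (1 + b) * U = 2 * p + b + s"
    using b by (simp add: U_def F_upper_def p_def [symmetric] s_def c_def [symmetric] b(1) field_simps)
  have L: "2 * (1 + b) * L = 2 * p + b - s"
    using b by (simp add: L_def F_lower_def p_def [symmetric] s_def c_def [symmetric] b(1) field_simps)
  \<comment> \<open>Completing the square, with \<open>s\<^sup>2\<close> the discriminant.\<close>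
  have sq: "(2 * (1 + b) * v - (2 * p + b))\<^sup>2 - s\<^sup>2 = 4 * (1 + b) * ((p - v)\<^sup>2 - b * (v * (1 - v)))" for v
    unfolding s2 by (simp add: power2_eq_square algebra_simps)
  have "(p - F)\<^sup>2 \<le> b * (F * (1 - F))"
  proof -
    have "sqrt n * \<bar>p - F\<bar> \<le> sqrt n * (c * sqrt (F * (1 - F)))"
      using dev assms by (simp add: p_def c_def abs_mult)
    then have "\<bar>p - F\<bar> \<le> c * sqrt (F * (1 - F))"
      using assms by simp
    then have "\<bar>p - F\<bar>\<^sup>2 \<le> (c * sqrt (F * (1 - F)))\<^sup>2"
      by (intro power_mono) auto
    then show ?thesis using assms by (simp add: power_mult_distrib b_def)
  qed
  moreover from this have "4 * (1 + b) * ((p - F)\<^sup>2 - b * (F * (1 - F))) \<le> 0"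
    using b by (intro mult_nonneg_nonpos) auto
  then have "(2 * (1 + b) * F - (2 * p + b))\<^sup>2 \<le> s\<^sup>2"
    using sq[of F] by simp
  then have "\<bar>2 * (1 + b) * F - (2 * p + b)\<bar> \<le> s"
    using s0 by (rule power2_le_iff_abs_le[THEN iffD1, rotated])
  then have "2 * (1 + b) * F \<le> 2 * (1 + b) * U" "2 * (1 + b) * L \<le> 2 * (1 + b) * F"
    unfolding U L by auto
  then have FU: "F \<le> U" and LF: "L \<le> F"
    using b by (auto simp: mult_le_cancel_left)
  have F: "\<bar>p - F\<bar> \<le> c * sqrt (1 - F)"
  proof -
    have "(p - F)\<^sup>2 \<le> b * (F * (1 - F))" by fact
    also have "\<dots> \<le> b * (1 - F)"
      using b assms by (intro mult_left_mono) (auto simp: mult_left_le_one_le)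
    also have "\<dots> = (c * sqrt (1 - F))\<^sup>2"
      using assms by (simp add: power_mult_distrib b_def)
    finally show ?thesis using assms c by (auto simp: abs_le_square_iff[symmetric])
  qed
  have root: "\<bar>p - v\<bar> \<le> c * sqrt (1 - v) \<and> v \<le> 1" if "v = U \<or> v = L" for v
  proof -
    have "4 * (1 + b) * ((p - v)\<^sup>2 - b * (v * (1 - v))) = 0"
      using sq[of v] that U L by auto
    then have eq: "(p - v)\<^sup>2 = b * (v * (1 - v))" using b by simp
    then have "0 \<le> b * (v * (1 - v))" by (metis zero_le_power2)
    then have v: "0 \<le> v" "v \<le> 1"
      using b by (auto simp: zero_le_mult_iff)
    have "(p - v)\<^sup>2 \<le> b * (1 - v)"
      unfolding eq using b v by (intro mult_left_mono) (auto simp: mult_left_le_one_le)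
    also have "\<dots> = (c * sqrt (1 - v))\<^sup>2"
      using v by (simp add: power_mult_distrib b_def)
    finally show ?thesis
      using v c by (auto simp: abs_le_square_iff[symmetric])
  qed
  have "U - F \<le> c * sqrt (1 - U) + c * sqrt (1 - F)"
    using root[of U] F by auto
  moreover have "c * sqrt (1 - U) \<le> c * sqrt (1 - F)"
    using FU c by (intro mult_left_mono) auto
  ultimately have UF2: "U - F \<le> 2 * c * sqrt (1 - F)" by simp
  have LF1: "F - L \<le> c * (sqrt (1 - L) + sqrt (1 - F))"
    using root[of L] F by (auto simp: distrib_left)
  have "L \<le> 1" using root[of L] by simp
  \<comment> \<open>\<open>F - L\<close> is the product of the sum and the difference of the two square roots.\<close>
  have "sqrt (1 - L) \<le> sqrt (1 - F) + c"
  proof (cases "sqrt (1 - L) + sqrt (1 - F) = 0")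
    case True
    then show ?thesis using c \<open>L \<le> 1\<close> assms by (smt (verit) real_sqrt_ge_zero)
  next
    case False
    have "(sqrt (1 - L) - sqrt (1 - F)) * (sqrt (1 - L) + sqrt (1 - F)) = F - L"
      using \<open>L \<le> 1\<close> assms by (simp add: algebra_simps)
    then have "(sqrt (1 - L) - sqrt (1 - F)) * (sqrt (1 - L) + sqrt (1 - F))
        \<le> c * (sqrt (1 - L) + sqrt (1 - F))"
      using LF1 by simp
    moreover have "0 < sqrt (1 - L) + sqrt (1 - F)"
      using False \<open>L \<le> 1\<close> assms by (smt (verit) real_sqrt_ge_zero)
    ultimately show ?thesis by (simp only: mult_le_cancel_right) simp
  qed
  then have "c * (sqrt (1 - L) + sqrt (1 - F)) \<le> c * (2 * sqrt (1 - F) + c)"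
    using c by (intro mult_left_mono) auto
  with LF1 have LF2: "F - L \<le> c * (2 * sqrt (1 - F) + c)" by simp
  show "F \<le> F_upper a n x t" "F_lower a n x t \<le> F"
    "F_upper a n x t - F \<le> 2 * (a / sqrt n) * sqrt (1 - F)"
    "F - F_lower a n x t \<le> a / sqrt n * (2 * sqrt (1 - F) + a / sqrt n)"
    using FU LF UF2 LF2 by (auto simp: U_def L_def c_def)
qed

section \<open>The estimate at one grid level\<close>

lemma grid_less_Suc: "2 \<le> n \<Longrightarrow> grid n j < grid n (j + 1)"
  by (simp add: grid_def divide_strict_right_mono)

lemma mu_hat_eqI:
  assumes "2 \<le> n" "0 < \<nu>" "mu_equation a n x j \<nu>"
  shows "mu_hat a n x j = \<nu>"
  unfolding mu_hat_def
proof (rule the_equality)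
  fix \<nu>' assume "\<nu>' > 0 \<and> mu_equation a n x j \<nu>'"
  with assms show "\<nu>' = \<nu>"
    using D_ratio_strict_antimono[OF grid_less_Suc[OF assms(1)], of \<nu> \<nu>' j]
      D_ratio_strict_antimono[OF grid_less_Suc[OF assms(1)], of \<nu>' \<nu> j]
    by (cases \<nu> \<nu>' rule: linorder_cases) (auto simp: mu_equation_def)
qed (use assms in auto)

lemma eps_hat_eqI:
  assumes "2 \<le> n" "0 < \<nu>" "mu_equation a n x j \<nu>"
  shows "eps_hat a n x j = (Phi (grid n j) - F_upper a n x (grid n j)) / window (grid n j) \<nu>"
  using assms mu_hat_eqI[OF assms] by (auto simp: eps_hat_def window_def)

text \<open>
  The data ratio is at most \<open>D(\<mu>)\<close>, so a solution \<open>\<nu>\<close> is at least \<open>\<mu>\<close>, and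
  \<open>\<epsilon> w(t, \<mu>) / w(t, \<nu>) \<le> \<epsilon>\<close>.
\<close>

lemma eps_hat_le:
  assumes "2 \<le> n" "0 < \<mu>" "0 < \<epsilon>"
    and up: "Phi (grid n j) - F_upper a n x (grid n j) \<le> \<epsilon> * window (grid n j) \<mu>"
    and lo: "\<epsilon> * window (grid n (j + 1)) \<mu> \<le> Phi (grid n (j + 1)) - F_lower a n x (grid n (j + 1))"
  shows "eps_hat a n x j \<le> \<epsilon>"
proof (cases "\<exists>\<nu>>0. mu_equation a n x j \<nu>")
  case False
  then have "eps_hat a n x j = 0" unfolding eps_hat_def by (rule if_not_P)
  then show ?thesis using assms by simp
next
  case True
  then obtain \<nu> where \<nu>: "0 < \<nu>" "mu_equation a n x j \<nu>" by blast
  let ?t = "grid n j" and ?t' = "grid n (j + 1)"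
  let ?A = "Phi ?t - F_upper a n x ?t" and ?B = "Phi ?t' - F_lower a n x ?t'"
  have w: "0 < window ?t \<mu>" "0 < window ?t' \<mu>" "0 < window ?t \<nu>"
    using assms \<nu> by (auto intro: window_pos)
  have "?A / ?B \<le> \<epsilon> * window ?t \<mu> / (\<epsilon> * window ?t' \<mu>)"
    using up lo w assms(3) by (intro frac_le) (auto intro: less_le_trans[OF mult_pos_pos])
  also have "\<dots> = D_ratio \<mu> ?t ?t'"
    using assms(3) by (simp add: D_ratio_window)
  finally have "D_ratio \<nu> ?t ?t' \<le> D_ratio \<mu> ?t ?t'"
    using \<nu>(2) by (simp add: mu_equation_def)
  then have "\<mu> \<le> \<nu>"
    using D_ratio_strict_antimono[OF grid_less_Suc[OF assms(1)] \<nu>(1), of \<mu> j] by linarith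
  then have "window ?t \<mu> \<le> window ?t \<nu>"
    using window_strict_mono[of \<mu> \<nu> ?t] by (cases "\<mu> = \<nu>") auto
  then have "\<epsilon> * window ?t \<mu> \<le> \<epsilon> * window ?t \<nu>"
    using assms(3) by (intro mult_left_mono) auto
  with up have "?A \<le> \<epsilon> * window ?t \<nu>" by simp
  then show ?thesis
    unfolding eps_hat_eqI[OF assms(1) \<nu>] using w by (simp add: divide_le_eq)
qed

text \<open>
  The data ratio lies between \<open>D(\<mu>) (1 - \<eta>) / (1 + \<eta>)\<close> and \<open>D(\<mu>)\<close>, hence between the values of \<open>D\<close> at
  \<open>\<mu> + h\<close> and \<open>\<mu>\<close>.  The intermediate value theorem yields a solution \<open>\<nu>\<close> between them, and
  \<open>w(t, \<nu>) \<le> w(t, \<mu> + h)\<close>.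
\<close>

lemma eps_hat_ge:
  assumes "2 \<le> n" "0 < \<mu>" "0 < \<epsilon>" "0 \<le> \<eta>" "\<eta> < 1" "0 < h"
    and up: "Phi (grid n j) - F_upper a n x (grid n j) \<le> \<epsilon> * window (grid n j) \<mu>"
    and lo: "\<epsilon> * window (grid n (j + 1)) \<mu> \<le> Phi (grid n (j + 1)) - F_lower a n x (grid n (j + 1))"
    and up': "(1 - \<eta>) * (\<epsilon> * window (grid n j) \<mu>) \<le> Phi (grid n j) - F_upper a n x (grid n j)"
    and lo': "Phi (grid n (j + 1)) - F_lower a n x (grid n (j + 1)) \<le> (1 + \<eta>) * (\<epsilon> * window (grid n (j + 1)) \<mu>)"
    and drop: "D_ratio (\<mu> + h) (grid n j) (grid n (j + 1))
      \<le> D_ratio \<mu> (grid n j) (grid n (j + 1)) * ((1 - \<eta>) / (1 + \<eta>))"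
  shows "(1 - \<eta>) * \<epsilon> * window (grid n j) \<mu> / window (grid n j) (\<mu> + h) \<le> eps_hat a n x j"
proof -
  let ?t = "grid n j" and ?t' = "grid n (j + 1)"
  let ?A = "Phi ?t - F_upper a n x ?t" and ?B = "Phi ?t' - F_lower a n x ?t'"
  have w: "0 < window ?t \<mu>" "0 < window ?t' \<mu>"
    using assms by (auto intro: window_pos)
  have A: "0 < ?A" using up' w assms by (intro less_le_trans[OF _ up']) auto
  have B: "0 < ?B" using lo w assms by (intro less_le_trans[OF _ lo]) auto
  have "?A / ?B \<le> \<epsilon> * window ?t \<mu> / (\<epsilon> * window ?t' \<mu>)"
    using up lo w assms(3) by (intro frac_le) auto
  also have "\<dots> = D_ratio \<mu> ?t ?t'"
    using assms(3) by (simp add: D_ratio_window)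
  finally have 1: "?A / ?B \<le> D_ratio \<mu> ?t ?t'" .
  have "D_ratio \<mu> ?t ?t' * ((1 - \<eta>) / (1 + \<eta>))
      = ((1 - \<eta>) * (\<epsilon> * window ?t \<mu>)) / ((1 + \<eta>) * (\<epsilon> * window ?t' \<mu>))"
    using assms(3) by (simp add: D_ratio_window mult_ac)
  also have "\<dots> \<le> ?A / ?B"
    using A B up' lo' by (intro frac_le) auto
  finally have 2: "D_ratio (\<mu> + h) ?t ?t' \<le> ?A / ?B" using drop by simp
  obtain \<nu> where \<nu>: "\<mu> \<le> \<nu>" "\<nu> \<le> \<mu> + h" "D_ratio \<nu> ?t ?t' = ?A / ?B"
    using IVT2[of "\<lambda>\<nu>. D_ratio \<nu> ?t ?t'" "\<mu> + h" "?A / ?B" \<mu>] 1 2 assms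
      isCont_D_ratio[of _ ?t ?t'] by auto
  have eps: "eps_hat a n x j = ?A / window ?t \<nu>"
    using \<nu> assms by (intro eps_hat_eqI) (auto simp: mu_equation_def)
  have "window ?t \<nu> \<le> window ?t (\<mu> + h)"
    using \<nu> window_strict_mono[of \<nu> "\<mu> + h" ?t] by (cases "\<nu> = \<mu> + h") auto
  moreover have "0 < window ?t \<nu>" using \<nu> assms by (intro window_pos) auto
  ultimately show ?thesis
    unfolding eps using up' A by (intro frac_le) (auto simp: mult_ac)
qed

section \<open>Signal and noise at the chosen level\<close>

text \<open>
  The left-hand side bounds the distance of \<open>F\<close> from the edges of the band at \<open>\<tau>\<close>, by \<open>band_bounds\<close> with
  \<open>sqrt n = exp (M\<^sup>2/4)\<close>; on the right stands a small multiple of the signal \<open>\<epsilon> w(\<tau>, \<mu>)\<close>.  The upper tail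
  \<open>1 - F\<close> is the sum of the null tail \<open>1 - \<Phi>(\<tau>)\<close> and of the signal itself.  The condition with
  \<open>(1 + x\<^sup>2)/2\<close> makes the signal dominate the fluctuation of the null tail; the condition with \<open>1\<close>
  says that many observations belong to the signal, so that it dominates its own fluctuation.
\<close>

lemma noise_bound:
  fixes M a \<beta> \<rho> x c \<tau> :: real
  assumes M: "1 \<le> M" "3 \<le> c * M" and a: "0 < a" "a \<le> M"
    and x: "c \<le> \<rho>" "c \<le> x - \<rho>" "x \<le> 1" "0 < c"
    and G: "c + \<beta> + (x - \<rho>)\<^sup>2 \<le> (1 + x\<^sup>2) / 2" and H: "c + \<beta> + (x - \<rho>)\<^sup>2 \<le> 1"
    and \<tau>: "x * M - 2 / M \<le> \<tau>" "\<tau> \<le> x * M"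
    and E: "3 * exp 2 * M ^ 3 * exp (- (c * M\<^sup>2 / 2)) \<le> 1"
  shows "a / exp (M\<^sup>2 / 4) * (2 * sqrt (1 - mixture_cdf (exp (- (\<beta> * M\<^sup>2 / 2))) (\<rho> * M) \<tau>)
           + a / exp (M\<^sup>2 / 4))
    \<le> 9 * sqrt (3 * exp 2 * M ^ 3 * exp (- (c * M\<^sup>2 / 2))) *
        (exp (- (\<beta> * M\<^sup>2 / 2)) * window \<tau> (\<rho> * M))"
proof -
  define \<kappa> where "\<kappa> = x - \<rho>"
  define S where "S = exp (- (\<beta> * M\<^sup>2 / 2)) * window \<tau> (\<rho> * M)"
  define T where "T = 1 - Phi \<tau>"
  define q where "q = a / exp (M\<^sup>2 / 4)"
  define E where "E = 3 * exp 2 * M ^ 3 * exp (- (c * M\<^sup>2 / 2))"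
  have M0: "0 < M" using M by simp
  have M2: "M \<le> M\<^sup>2" using M by (simp add: power2_eq_square)
  have inv: "1 / M \<le> 1" "0 < 1 / M" "2 / M \<le> 2" using M by (auto simp: divide_le_eq)
  have cM: "c * M \<le> \<rho> * M" "c * M \<le> x * M - \<rho> * M"
    using x M0 by (auto simp: mult_right_mono left_diff_distrib [symmetric])
  have xM: "x * M \<le> M" using x M0 by simp
  have order: "1 / M \<le> \<rho> * M" "\<rho> * M \<le> \<tau>" "1 \<le> \<tau>" "\<tau> \<le> M"
    using cM xM \<tau> M inv by linarith+
  \<comment> \<open>Lower bound for the signal \<open>S\<close>, multiplied by \<open>E\<close> for use against both noise terms.\<close>
  have "std_normal_density (\<tau> - \<rho> * M) \<ge> exp (- (\<kappa>\<^sup>2 * M\<^sup>2 / 2)) / 3"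
  proof -
    have "(\<tau> - \<rho> * M)\<^sup>2 \<le> (\<kappa> * M)\<^sup>2"
      using order \<tau> by (intro power_mono) (auto simp: \<kappa>_def left_diff_distrib)
    then have "- (\<kappa>\<^sup>2 * M\<^sup>2 / 2) \<le> - ((\<tau> - \<rho> * M)\<^sup>2) / 2"
      by (simp add: power_mult_distrib)
    moreover have "sqrt (2 * pi) \<le> 3"
      using pi_less_4 by (intro real_le_lsqrt) auto
    ultimately have "exp (- (\<kappa>\<^sup>2 * M\<^sup>2 / 2)) / 3 \<le> exp (- ((\<tau> - \<rho> * M)\<^sup>2) / 2) / sqrt (2 * pi)"
      by (intro frac_le) auto
    then show ?thesis
      by (simp add: std_normal_density_def)
  qed
  then have "exp (- 2) * (exp (- (\<kappa>\<^sup>2 * M\<^sup>2 / 2)) / 3) / M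
      \<le> exp (- 2) * std_normal_density (\<tau> - \<rho> * M) / M"
    using M0 by (intro divide_right_mono mult_left_mono) auto
  also have "\<dots> \<le> window \<tau> (\<rho> * M)"
    using order M by (intro window_ge) auto
  finally have "exp (- (\<beta> * M\<^sup>2 / 2)) * (exp (- 2) * (exp (- (\<kappa>\<^sup>2 * M\<^sup>2 / 2)) / 3) / M) \<le> S"
    unfolding S_def by (intro mult_left_mono) auto
  then have "E * (exp (- (\<beta> * M\<^sup>2 / 2)) * (exp (- 2) * (exp (- (\<kappa>\<^sup>2 * M\<^sup>2 / 2)) / 3) / M)) \<le> E * S"
    using M0 by (intro mult_left_mono) (auto simp: E_def)
  also have "E * (exp (- (\<beta> * M\<^sup>2 / 2)) * (exp (- 2) * (exp (- (\<kappa>\<^sup>2 * M\<^sup>2 / 2)) / 3) / M))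
      = M\<^sup>2 * exp (- ((c + \<beta> + \<kappa>\<^sup>2) * M\<^sup>2 / 2))"
  proof -
    have "exp (- ((c + \<beta> + \<kappa>\<^sup>2) * M\<^sup>2 / 2))
        = exp (- (c * M\<^sup>2 / 2)) * exp (- (\<beta> * M\<^sup>2 / 2)) * exp (- (\<kappa>\<^sup>2 * M\<^sup>2 / 2))"
      by (simp add: exp_add [symmetric] field_simps)
    moreover have "3 * e * M ^ 3 * g * (p * (inverse e * (k / 3) / M)) = M\<^sup>2 * (g * p * k)"
      if "e \<noteq> 0" for e g p k :: real
      using M0 that by (simp add: field_simps power2_eq_square power3_eq_cube)
    ultimately show ?thesis
      unfolding E_def exp_minus[of "2::real"] by simp
  qed
  finally have ES: "M\<^sup>2 * exp (- ((c + \<beta> + \<kappa>\<^sup>2) * M\<^sup>2 / 2)) \<le> E * S" .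
  have S0: "0 < S"
    using x M0 unfolding S_def by (intro mult_pos_pos window_pos) auto
  have E0: "0 < E" using M0 by (simp add: E_def)
  have q0: "0 < q" using a by (simp add: q_def)
  have T0: "0 \<le> T" using Phi_less_1[of \<tau>] by (simp add: T_def)
  have sqE: "E \<le> sqrt E"
    using E0 E unfolding E_def [symmetric] by (intro real_le_rsqrt) (simp add: power2_eq_square)
  \<comment> \<open>The signal against its own fluctuation.\<close>
  have q2: "q\<^sup>2 \<le> E * S"
  proof -
    have "q\<^sup>2 = a\<^sup>2 * exp (- (1 * M\<^sup>2 / 2))"
      by (simp add: q_def power_divide exp_double [symmetric] exp_minus inverse_eq_divide)
    also have "\<dots> \<le> M\<^sup>2 * exp (- ((c + \<beta> + \<kappa>\<^sup>2) * M\<^sup>2 / 2))"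
      using a H by (intro mult_mono power_mono) (auto intro!: mult_right_mono simp: \<kappa>_def)
    finally show ?thesis using ES by simp
  qed
  \<comment> \<open>The signal against the fluctuation of the null tail \<open>T\<close>.\<close>
  have qT: "q * sqrt T \<le> exp 1 * (E * S)"
  proof -
    have "(x * M - 2 / M)\<^sup>2 \<le> \<tau>\<^sup>2"
      using \<tau> cM M inv by (intro power_mono) linarith+
    moreover have "(x * M - 2 / M)\<^sup>2 = x\<^sup>2 * M\<^sup>2 - 4 * x + (2 / M)\<^sup>2"
      using M0 by (simp add: power2_eq_square field_simps)
    ultimately have "x\<^sup>2 * M\<^sup>2 - 4 \<le> \<tau>\<^sup>2"
      using x zero_le_power2[of "2 / M"] by linarith
    then have "- (\<tau>\<^sup>2) / 2 \<le> 2 + - (x\<^sup>2 * M\<^sup>2 / 2)" by simp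
    then have "exp (- (\<tau>\<^sup>2) / 2) \<le> exp 2 * exp (- (x\<^sup>2 * M\<^sup>2 / 2))"
      by (simp only: exp_add [symmetric] exp_le_cancel_iff)
    moreover have "T \<le> exp (- (\<tau>\<^sup>2) / 2)"
    proof -
      have "T \<le> std_normal_density \<tau>"
        unfolding T_def by (rule Phi_tail_le) fact
      also have "\<dots> \<le> exp (- (\<tau>\<^sup>2) / 2)"
      proof -
        have "1 \<le> sqrt (2 * pi)" using pi_gt3 by simp
        then show ?thesis unfolding std_normal_density_def
          by (simp add: divide_le_eq mult_le_cancel_left1)
      qed
      finally show ?thesis .
    qed
    ultimately have "T \<le> exp 2 * exp (- (x\<^sup>2 * M\<^sup>2 / 2))" by simp
    also have "\<dots> = (exp 1 * exp (- (x\<^sup>2 * M\<^sup>2 / 4)))\<^sup>2"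
      by (simp add: power_mult_distrib exp_double [symmetric])
    finally have "sqrt T \<le> exp 1 * exp (- (x\<^sup>2 * M\<^sup>2 / 4))"
      by (intro real_le_lsqrt) auto
    then have "q * sqrt T \<le> q * (exp 1 * exp (- (x\<^sup>2 * M\<^sup>2 / 4)))"
      using q0 by (intro mult_left_mono) auto
    also have "\<dots> = exp 1 * (a * (exp (- (M\<^sup>2 / 4)) * exp (- (x\<^sup>2 * M\<^sup>2 / 4))))"
      by (simp add: q_def exp_minus inverse_eq_divide)
    also have "exp (- (M\<^sup>2 / 4)) * exp (- (x\<^sup>2 * M\<^sup>2 / 4)) = exp (- ((1 + x\<^sup>2) / 2 * M\<^sup>2 / 2))"
      by (simp add: exp_add [symmetric] field_simps)
    also have "a * \<dots> \<le> M\<^sup>2 * exp (- ((c + \<beta> + \<kappa>\<^sup>2) * M\<^sup>2 / 2))"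
      using a M2 G by (intro mult_mono) (auto intro!: mult_right_mono simp: \<kappa>_def)
    also have "\<dots> \<le> E * S" by (rule ES)
    finally show ?thesis by simp
  qed
  have qS: "q \<le> sqrt E * sqrt S"
    using q2 q0 by (simp add: real_sqrt_mult [symmetric] real_le_rsqrt)
  have "q * sqrt (T + S) \<le> q * (sqrt T + sqrt S)"
    using T0 S0 q0 by (intro mult_left_mono sqrt_add_le_add_sqrt) auto
  moreover have "q * sqrt S \<le> sqrt E * sqrt S * sqrt S"
    using qS S0 by (intro mult_right_mono) auto
  then have "q * sqrt S \<le> sqrt E * S" using S0 by (simp only: mult.assoc real_sqrt_mult_self abs_of_pos)
  ultimately have "2 * (q * sqrt (T + S)) + q\<^sup>2 \<le> 2 * (exp 1 * (E * S) + sqrt E * S) + E * S"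
    using qT q2 by (simp add: distrib_left)
  also have "\<dots> = (2 * exp 1 + 1) * (E * S) + 2 * (sqrt E * S)"
    by (simp add: algebra_simps)
  also have "\<dots> \<le> 7 * (sqrt E * S) + 2 * (sqrt E * S)"
    using sqE S0 E0 exp_le by (intro add_right_mono mult_mono mult_right_mono) auto
  also have "\<dots> = 9 * sqrt E * S" by simp
  also have "2 * (q * sqrt (T + S)) + q\<^sup>2 = q * (2 * sqrt (1 - (Phi \<tau> - S)) + q)"
    by (simp add: T_def power2_eq_square algebra_simps)
  finally show ?thesis unfolding mixture_cdf_def S_def E_def q_def .
qed

section \<open>Accuracy on good samples\<close>

text \<open>
  The range of \<open>k\<close> exceeds that of the index of the estimator by one, because the equation with
  index \<open>j\<close> also involves the grid point \<open>j + 1\<close>.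
\<close>

definition good_sample :: "real \<Rightarrow> nat \<Rightarrow> (real \<Rightarrow> real) \<Rightarrow> (nat \<Rightarrow> real) \<Rightarrow> bool" where
  "good_sample a n F x \<longleftrightarrow>
     (\<forall>k. 1 \<le> k \<and> real k \<le> 2 * ln n + 1 \<longrightarrow>
        \<bar>sqrt n * (ecdf n x (grid n k) - F (grid n k))\<bar>
          \<le> a * sqrt (F (grid n k) * (1 - F (grid n k))))"

lemma eps_hat_le_on_good_sample:
  assumes "2 \<le> n" "0 < a" "0 < \<epsilon>" "\<epsilon> \<le> 1" "0 < \<mu>" "good_sample a n (mixture_cdf \<epsilon> \<mu>) x"
    "1 \<le> j" "real j \<le> 2 * ln n"
  shows "eps_hat a n x j \<le> \<epsilon>"
proof (rule eps_hat_le)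
  have F: "0 \<le> mixture_cdf \<epsilon> \<mu> t" "mixture_cdf \<epsilon> \<mu> t \<le> 1" for t
    using mixture_cdf_mem[of \<epsilon> \<mu> t] assms by auto
  have n: "0 < n" using assms by simp
  have dev: "\<bar>sqrt n * (ecdf n x (grid n k) - mixture_cdf \<epsilon> \<mu> (grid n k))\<bar>
        \<le> a * sqrt (mixture_cdf \<epsilon> \<mu> (grid n k) * (1 - mixture_cdf \<epsilon> \<mu> (grid n k)))"
    if "k = j \<or> k = j + 1" for k
    using assms that by (auto simp: good_sample_def)
  show "Phi (grid n j) - F_upper a n x (grid n j) \<le> \<epsilon> * window (grid n j) \<mu>"
    using band_bounds(1)[OF n assms(2) F dev[of j]] by (simp add: mixture_cdf_def)
  show "\<epsilon> * window (grid n (j + 1)) \<mu> \<le> Phi (grid n (j + 1)) - F_lower a n x (grid n (j + 1))"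
    using band_bounds(2)[OF n assms(2) F dev[of "j + 1"]] by (simp add: mixture_cdf_def)
qed (use assms in auto)

text \<open>
  The level used for the lower bound is \<open>t = (j - 1)/M\<close> with \<open>j = \<lfloor>x M\<^sup>2\<rfloor>\<close>, so that both \<open>t\<close> and
  the next grid point \<open>t'\<close> lie between \<open>x M - 2/M\<close> and \<open>x M\<close>.  The second
  hypothesis on \<open>\<eta>\<close> says that the drop of \<open>D\<close> over a step \<open>b/M\<close> outweighs the noise.
\<close>

lemma eps_star_bounds_on_good_sample:
  fixes M a \<beta> \<rho> x c b :: real
  defines "\<eta> \<equiv> 9 * sqrt (3 * exp 2 * M ^ 3 * exp (- (c * M\<^sup>2 / 2)))"
  defines "\<epsilon> \<equiv> exp (- (\<beta> * M\<^sup>2 / 2))"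
  assumes n: "2 \<le> n" "M = sqrt (2 * ln n)"
    and M: "1 \<le> M" "3 \<le> c * M" and a: "0 < a" "a \<le> M"
    and x: "c \<le> \<rho>" "c \<le> x - \<rho>" "x \<le> 1" "0 < c" "0 \<le> \<beta>"
    and G: "c + \<beta> + (x - \<rho>)\<^sup>2 \<le> (1 + x\<^sup>2) / 2" and H: "c + \<beta> + (x - \<rho>)\<^sup>2 \<le> 1"
    and b: "0 < b" "b \<le> 1"
    and \<eta>: "\<eta> < 1"
      "1 - (1 - exp (- (b / (2 * M\<^sup>2)))) * (b * exp (- b) / (4 * M\<^sup>2)) \<le> (1 - \<eta>) / (1 + \<eta>)"
    and good: "good_sample a n (mixture_cdf \<epsilon> (\<rho> * M)) X"
  shows "eps_star a n X \<le> \<epsilon>" "(1 - \<eta>) / (1 + b * exp (b + 2)) * \<epsilon> \<le> eps_star a n X"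
proof -
  define \<mu> where "\<mu> = \<rho> * M"
  have M0: "0 < M" using M by simp
  have Msq: "M\<^sup>2 = 2 * ln n" using n by simp
  have inv: "1 / M \<le> 1" "0 < 1 / M" "2 / M \<le> 2" using M by (auto simp: divide_le_eq)
  have bM: "b / M \<le> 1 / M" "0 < b / M" using b M0 by (auto simp: divide_right_mono)
  have cM: "c * M \<le> \<rho> * M" "c * M \<le> x * M - \<rho> * M"
    using x M0 by (auto simp: mult_right_mono left_diff_distrib [symmetric])
  have xM: "x * M \<le> M" using x M0 by simp
  have "0 < \<mu>" using cM M by (auto simp: \<mu>_def intro: less_le_trans[of 0 "c * M"])
  have eps: "0 < \<epsilon>" "\<epsilon> \<le> 1" using x by (auto simp: \<epsilon>_def)
  define J where "J = {j. 1 \<le> j \<and> real j \<le> 2 * ln n}"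
  have fin: "finite J"
    by (rule finite_subset[of _ "{..nat \<lfloor>2 * ln n\<rfloor>}"]) (auto simp: J_def le_nat_floor)
  have star: "eps_star a n X = Max (eps_hat a n X ` J)"
    by (simp add: eps_star_def J_def)
  define j where "j = nat \<lfloor>x * M\<^sup>2\<rfloor>"
  have "3 * 1 \<le> c * M * M" using M by (intro mult_mono) auto
  also have "\<dots> \<le> x * M * M" using M0 x by (intro mult_right_mono) auto
  finally have x2: "3 \<le> x * M\<^sup>2" by (simp add: power2_eq_square)
  have j: "real j \<le> x * M\<^sup>2" "x * M\<^sup>2 < real j + 1"
    using x2 unfolding j_def by linarith+
  have "x * M\<^sup>2 \<le> 1 * M\<^sup>2" using x by (intro mult_right_mono) auto
  then have jJ: "j \<in> J" using j x2 Msq by (auto simp: J_def)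
  define t where "t = grid n j"
  define t' where "t' = grid n (j + 1)"
  have t_eq: "t = (real j - 1) / M" "t' = real j / M"
    by (auto simp: t_def t'_def grid_def n)
  have tt': "t' = t + 1 / M" unfolding t_eq by (simp add: diff_divide_distrib)
  have "x * M\<^sup>2 / M = x * M" using M0 by (simp add: power2_eq_square)
  then have "real j / M \<le> x * M" "x * M \<le> (real j + 1) / M"
    using divide_right_mono[OF j(1), of M] divide_right_mono[OF less_imp_le[OF j(2)], of M] M0
    by auto
  then have t': "t' \<le> x * M" "x * M - 1 / M \<le> t'"
    by (auto simp: t_eq add_divide_distrib)
  have "2 / M = 1 / M + 1 / M" by simp
  then have tr: "x * M - 2 / M \<le> t" "t \<le> x * M" "x * M - 2 / M \<le> t'"
    using t' inv unfolding tt' by linarith+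
  have E: "0 \<le> \<eta>" "3 * exp 2 * M ^ 3 * exp (- (c * M\<^sup>2 / 2)) \<le> 1"
  proof -
    show "0 \<le> \<eta>" using M0 by (simp add: \<eta>_def)
    have "sqrt (3 * exp 2 * M ^ 3 * exp (- (c * M\<^sup>2 / 2))) \<le> 1"
      using \<eta>(1) \<open>0 \<le> \<eta>\<close> unfolding \<eta>_def by linarith
    then show "3 * exp 2 * M ^ 3 * exp (- (c * M\<^sup>2 / 2)) \<le> 1" by simp
  qed
  have F: "0 \<le> mixture_cdf \<epsilon> \<mu> s" "mixture_cdf \<epsilon> \<mu> s \<le> 1" for s
    using mixture_cdf_mem[of \<epsilon> \<mu> s] eps by auto
  have n0: "0 < n" using n by simp
  have dev: "\<bar>sqrt n * (ecdf n X (grid n k) - mixture_cdf \<epsilon> \<mu> (grid n k))\<bar>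
        \<le> a * sqrt (mixture_cdf \<epsilon> \<mu> (grid n k) * (1 - mixture_cdf \<epsilon> \<mu> (grid n k)))"
    if "k = j \<or> k = j + 1" for k
    using good jJ that by (auto simp: good_sample_def J_def \<mu>_def)
  note band = band_bounds[OF n0 a(1) F dev]
  have "sqrt n = exp (M\<^sup>2 / 4)"
  proof (rule real_sqrt_unique)
    show "(exp (M\<^sup>2 / 4))\<^sup>2 = real n"
      using n0 by (simp add: exp_double [symmetric] Msq)
  qed simp
  note noise = noise_bound[OF M a x(1-4) G H _ _ E(2), folded \<eta>_def \<epsilon>_def \<mu>_def this]
  have "2 * (a / sqrt n) * sqrt (1 - mixture_cdf \<epsilon> \<mu> t)
      \<le> a / sqrt n * (2 * sqrt (1 - mixture_cdf \<epsilon> \<mu> t) + a / sqrt n)"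
    by (simp add: algebra_simps)
  also have "\<dots> \<le> \<eta> * (\<epsilon> * window t \<mu>)"
    using noise[of t] tr by simp
  finally have up': "(1 - \<eta>) * (\<epsilon> * window t \<mu>) \<le> Phi t - F_upper a n X t"
    using band(3)[of j] unfolding t_def [symmetric] by (simp add: mixture_cdf_def left_diff_distrib)
  have lo': "Phi t' - F_lower a n X t' \<le> (1 + \<eta>) * (\<epsilon> * window t' \<mu>)"
    using band(4)[of "j + 1"] noise[of t'] tr t' unfolding t'_def [symmetric]
    by (auto simp: mixture_cdf_def algebra_simps)
  have up: "Phi t - F_upper a n X t \<le> \<epsilon> * window t \<mu>"
    using band(1)[of j] unfolding t_def [symmetric] by (auto simp: mixture_cdf_def)
  have lo: "\<epsilon> * window t' \<mu> \<le> Phi t' - F_lower a n X t'"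
    using band(2)[of "j + 1"] unfolding t'_def [symmetric] by (auto simp: mixture_cdf_def)
  have ord: "t' \<le> M" "t \<le> M" "\<mu> \<le> M" "\<mu> + b / M \<le> t" "\<mu> + b / M \<le> t'" "1 / M \<le> \<mu>"
    using t' tr xM cM M inv bM unfolding \<mu>_def by linarith+
  have "D_ratio (\<mu> + b / M) t t' \<le> D_ratio \<mu> t t' *
      (1 - (1 - exp (- (b / (2 * M\<^sup>2)))) * (b * exp (- b) / (4 * M\<^sup>2)))"
    using M ord tt' \<open>0 < \<mu>\<close> b by (intro D_ratio_drop) auto
  also have "\<dots> \<le> D_ratio \<mu> t t' * ((1 - \<eta>) / (1 + \<eta>))"
    using \<eta>(2) D_ratio_pos[OF \<open>0 < \<mu>\<close>, of t t'] by (intro mult_left_mono) auto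
  finally have drop: "D_ratio (\<mu> + b / M) t t' \<le> D_ratio \<mu> t t' * ((1 - \<eta>) / (1 + \<eta>))" .
  have low: "(1 - \<eta>) * \<epsilon> * window t \<mu> / window t (\<mu> + b / M) \<le> eps_hat a n X j"
    using eps_hat_ge[OF n(1) \<open>0 < \<mu>\<close> eps(1) E(1) \<eta>(1) bM(2), of j a X] up lo up' lo' drop
    unfolding t_def t'_def by blast
  have "(1 - \<eta>) / (1 + b * exp (b + 2)) * \<epsilon>
      = (1 - \<eta>) * \<epsilon> * window t \<mu> / ((1 + b * exp (b + 2)) * window t \<mu>)"
    using window_pos[OF \<open>0 < \<mu>\<close>, of t] by simp
  also have "\<dots> \<le> (1 - \<eta>) * \<epsilon> * window t \<mu> / window t (\<mu> + b / M)"
  proof -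
    have "0 < 1 + b * exp (b + 2)" using b by (intro add_pos_pos) auto
    moreover have "0 < window t (\<mu> + b / M)"
      using \<open>0 < \<mu>\<close> bM by (intro window_pos add_pos_pos)
    ultimately show ?thesis
      using window_shift_le[of M t \<mu> b] M ord b eps \<eta> window_pos[OF \<open>0 < \<mu>\<close>, of t]
      by (intro divide_left_mono) auto
  qed
  also note low
  also have "eps_hat a n X j \<le> eps_star a n X"
    unfolding star using fin jJ by (intro Max_ge) auto
  finally show "(1 - \<eta>) / (1 + b * exp (b + 2)) * \<epsilon> \<le> eps_star a n X" .
  show "eps_star a n X \<le> \<epsilon>"
    unfolding star using fin jJ eps_hat_le_on_good_sample[OF n(1) a(1) eps \<open>0 < \<mu>\<close> good[folded \<mu>_def]]
    by (intro Max.boundedI) (auto simp: J_def)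
qed

text \<open>
  Given the tolerance \<open>\<delta>\<close>, the step \<open>b\<close> is chosen with \<open>b exp (b + 2) \<le> \<delta>/2\<close>; the remaining hypotheses of
  \<open>eps_star_bounds_on_good_sample\<close> are satisfied for large \<open>M\<close>, uniformly in the parameters because only \<open>b\<close>
  and \<open>c\<close> enter them.
\<close>

lemma eps_star_eventually_close:
  fixes a :: "nat \<Rightarrow> real"
  assumes a: "(\<lambda>n. a n / sqrt (2 * ln (ln (real n)))) \<longlonglongrightarrow> 1" and "0 < c" "0 < \<delta>"
  shows "\<forall>\<^sub>F n in sequentially. \<forall>\<beta> \<rho> x X.
      c \<le> \<rho> \<longrightarrow> c \<le> x - \<rho> \<longrightarrow> x \<le> 1 \<longrightarrow> 0 \<le> \<beta> \<longrightarrow> c + \<beta> + (x - \<rho>)\<^sup>2 \<le> (1 + x\<^sup>2) / 2 \<longrightarrow>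
      c + \<beta> + (x - \<rho>)\<^sup>2 \<le> 1 \<longrightarrow>
      good_sample (a n) n (mixture_cdf (eps_seq \<beta> n) (\<rho> * sqrt (2 * ln n))) X \<longrightarrow>
      \<bar>eps_star (a n) n X / eps_seq \<beta> n - 1\<bar> < \<delta>"
proof -
  define \<eta> where "\<eta> M = 9 * sqrt (3 * exp 2 * M ^ 3 * exp (- (c * M\<^sup>2 / 2)))" for M :: real
  define b where "b = min 1 (\<delta> / (2 * exp 3))"
  have b: "0 < b" "b \<le> 1" using assms by (auto simp: b_def)
  have "b * exp (b + 2) \<le> \<delta> / (2 * exp 3) * exp 3"
    using b assms by (intro mult_mono) (auto simp: b_def)
  then have b2: "b * exp (b + 2) \<le> \<delta> / 2" by simp
  define M where "M n = sqrt (2 * ln (real n))" for n :: nat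
  have Mtop: "filterlim M at_top sequentially"
    unfolding M_def by real_asymp
  have \<eta>_lim: "(\<eta> \<longlongrightarrow> 0) at_top"
    unfolding \<eta>_def using \<open>0 < c\<close> by real_asymp
  have ev: "\<forall>\<^sub>F M in at_top. \<eta> M < min 1 (\<delta> / 4)"
    using order_tendstoD(2)[OF \<eta>_lim, of "min 1 (\<delta> / 4)"] \<open>0 < \<delta>\<close> by simp
  have ev1: "\<forall>\<^sub>F M in at_top. 3 \<le> c * M" "\<forall>\<^sub>F M in at_top. (1::real) \<le> M"
    using \<open>0 < c\<close> by real_asymp+
  define K where "K = b * exp (- b) / 4"
  have "0 < K" using b by (simp add: K_def)
  \<comment> \<open>The left side stays below \<open>1\<close> by order \<open>M\<^sup>-\<^sup>4\<close>, the right side by an exponentially small amount.\<close>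
  have ev2: "\<forall>\<^sub>F M in at_top. 1 - (1 - exp (- (b / (2 * M\<^sup>2)))) * (K / M\<^sup>2)
      \<le> (1 - \<eta> M) / (1 + \<eta> M)"
    unfolding \<eta>_def using \<open>0 < c\<close> \<open>0 < K\<close> b(1) by real_asymp
  have evM: "\<forall>\<^sub>F n in sequentially. \<eta> (M n) < min 1 (\<delta> / 4) \<and> 3 \<le> c * M n \<and> 1 \<le> M n \<and>
      1 - (1 - exp (- (b / (2 * (M n)\<^sup>2)))) * (K / (M n)\<^sup>2) \<le> (1 - \<eta> (M n)) / (1 + \<eta> (M n))"
    using eventually_compose_filterlim[OF ev Mtop] eventually_compose_filterlim[OF ev1(1) Mtop]
      eventually_compose_filterlim[OF ev1(2) Mtop] eventually_compose_filterlim[OF ev2 Mtop]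
    by eventually_elim blast
  have "\<forall>\<^sub>F n in sequentially. 1 / 2 < a n / sqrt (2 * ln (ln (real n)))"
       "\<forall>\<^sub>F n in sequentially. a n / sqrt (2 * ln (ln (real n))) < 2"
    by (rule order_tendstoD[OF a]; simp)+
  moreover have "\<forall>\<^sub>F n in sequentially. 0 < sqrt (2 * ln (ln (real n)))"
    "\<forall>\<^sub>F n in sequentially. 2 * sqrt (2 * ln (ln (real n))) \<le> sqrt (2 * ln (real n))"
    by real_asymp+
  ultimately have evA: "\<forall>\<^sub>F n in sequentially. 0 < a n \<and> a n \<le> M n"
  proof eventually_elim
    case (elim n)
    then have "1 / 2 * sqrt (2 * ln (ln (real n))) < a n" "a n < 2 * sqrt (2 * ln (ln (real n)))"
      by (auto simp: field_simps)
    with elim show ?case by (auto simp: M_def)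
  qed
  show ?thesis
    using evM evA eventually_ge_at_top[of 2]
  proof eventually_elim
    case (elim n)
    show ?case
    proof (intro allI impI)
      fix \<beta> \<rho> x X
      assume x: "c \<le> \<rho>" "c \<le> x - \<rho>" "x \<le> 1" "0 \<le> \<beta>"
        and GH: "c + \<beta> + (x - \<rho>)\<^sup>2 \<le> (1 + x\<^sup>2) / 2" "c + \<beta> + (x - \<rho>)\<^sup>2 \<le> 1"
        and good: "good_sample (a n) n (mixture_cdf (eps_seq \<beta> n) (\<rho> * sqrt (2 * ln n))) X"
      have \<epsilon>: "eps_seq \<beta> n = exp (- (\<beta> * (M n)\<^sup>2 / 2))"
        using elim by (simp add: eps_seq_def powr_def M_def)
      let ?\<epsilon> = "eps_seq \<beta> n" and ?\<eta> = "\<eta> (M n)"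
      have "0 < ?\<epsilon>" by (simp add: \<epsilon>)
      have "eps_star (a n) n X \<le> ?\<epsilon>" and
        low: "(1 - ?\<eta>) / (1 + b * exp (b + 2)) * ?\<epsilon> \<le> eps_star (a n) n X"
        using eps_star_bounds_on_good_sample[of n "M n" c "a n" \<rho> x \<beta> b X, folded \<eta>_def \<epsilon>] elim x GH b good
          \<open>0 < c\<close> by (auto simp: M_def K_def)
      have "(1 - \<delta>) * (1 + \<delta> / 2) < 1 - ?\<eta>"
      proof -
        have "(1 - \<delta>) * (1 + \<delta> / 2) = 1 - \<delta> / 2 - \<delta> * \<delta> / 2"
          by (simp add: field_simps)
        moreover have "0 < \<delta> * \<delta>" using \<open>0 < \<delta>\<close> by simp
        moreover have "?\<eta> < \<delta> / 4" using elim by auto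
        ultimately show ?thesis using \<open>0 < \<delta>\<close> by linarith
      qed
      then have "1 - \<delta> < (1 - ?\<eta>) / (1 + \<delta> / 2)"
        using \<open>0 < \<delta>\<close> by (simp add: less_divide_eq)
      also have "\<dots> \<le> (1 - ?\<eta>) / (1 + b * exp (b + 2))"
        using b b2 elim \<open>0 < \<delta>\<close> by (intro divide_left_mono) (auto intro!: add_pos_pos mult_pos_pos)
      also have "\<dots> \<le> eps_star (a n) n X / ?\<epsilon>"
        using low \<open>0 < ?\<epsilon>\<close> by (simp add: pos_le_divide_eq)
      finally have "1 - \<delta> < eps_star (a n) n X / ?\<epsilon>" .
      moreover have "eps_star (a n) n X / ?\<epsilon> \<le> 1"
        using \<open>eps_star (a n) n X \<le> ?\<epsilon>\<close> \<open>0 < ?\<epsilon>\<close> by (simp add: divide_le_eq)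
      ultimately show "\<bar>eps_star (a n) n X / ?\<epsilon> - 1\<bar> < \<delta>"
        using \<open>0 < \<delta>\<close> by linarith
    qed
  qed
qed

section \<open>The probability integral transform\<close>

lemma prob_space_uniform: "prob_space (uniform_measure lborel {0<..<1::real})"
  by (rule prob_space_uniform_measure) auto

lemma normal_mixture_cdf:
  assumes "0 \<le> \<epsilon>" "\<epsilon> \<le> 1"
  shows "real_distribution (normal_mixture \<epsilon> \<mu>)" "cdf (normal_mixture \<epsilon> \<mu>) = mixture_cdf \<epsilon> \<mu>"
proof -
  have shift: "distributed std_normal_distribution lborel (\<lambda>x. \<mu> + 1 * x) (normal_density (\<mu> + 1 * 0) (\<bar>1\<bar> * 1))"
    by (rule std_normal.normal_density_affine)
       (auto simp: distributed_def distr_id2 intro!: measurable_ident_sets)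
  have sh: "emeasure (density lborel (normal_density \<mu> 1)) A
      = emeasure std_normal_distribution ((\<lambda>x. \<mu> + x) -` A)" if "A \<in> sets borel" for A
  proof -
    have "density lborel (normal_density \<mu> 1) = distr std_normal_distribution lborel (\<lambda>x. \<mu> + x)"
      using distributed_distr_eq_density[OF shift] by simp
    then show ?thesis using that by (simp add: emeasure_distr)
  qed
  have em: "emeasure (normal_mixture \<epsilon> \<mu>) A
      = ennreal (1 - \<epsilon>) * emeasure std_normal_distribution A
        + ennreal \<epsilon> * emeasure std_normal_distribution ((\<lambda>x. \<mu> + x) -` A)"
    if A: "A \<in> sets borel" for A
  proof -
    have "emeasure (normal_mixture \<epsilon> \<mu>) A = (\<integral>\<^sup>+x. ennreal (1 - \<epsilon>) * (ennreal (std_normal_density x) * indicator A x)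
        + ennreal \<epsilon> * (ennreal (normal_density \<mu> 1 x) * indicator A x) \<partial>lborel)"
      unfolding normal_mixture_def using A assms
      by (subst emeasure_density)
         (auto intro!: nn_integral_cong simp: indicator_def ennreal_plus[symmetric] ennreal_mult[symmetric]
           simp del: ennreal_plus)
    also have "\<dots> = ennreal (1 - \<epsilon>) * emeasure std_normal_distribution A
        + ennreal \<epsilon> * emeasure (density lborel (normal_density \<mu> 1)) A"
      using A by (subst nn_integral_add)
        (auto simp: nn_integral_cmult emeasure_density)
    finally show ?thesis using sh[OF A] by simp
  qed
  have "prob_space (normal_mixture \<epsilon> \<mu>)"
  proof (rule prob_spaceI)
    have "space (normal_mixture \<epsilon> \<mu>) = UNIV" by (simp add: normal_mixture_def)
    then show "emeasure (normal_mixture \<epsilon> \<mu>) (space (normal_mixture \<epsilon> \<mu>)) = 1"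
      using em[of UNIV] assms std_normal.emeasure_space_1
      by (simp add: ennreal_plus[symmetric] del: ennreal_plus)
  qed
  then interpret N: prob_space "normal_mixture \<epsilon> \<mu>" .
  show "real_distribution (normal_mixture \<epsilon> \<mu>)"
    by unfold_locales (auto simp: normal_mixture_def)
  show "cdf (normal_mixture \<epsilon> \<mu>) = mixture_cdf \<epsilon> \<mu>"
  proof
    fix t
    have "(\<lambda>x. \<mu> + x) -` {..t} = {..t - \<mu>}" by auto
    then have "ennreal (measure (normal_mixture \<epsilon> \<mu>) {..t})
        = ennreal (1 - \<epsilon>) * ennreal (Phi t) + ennreal \<epsilon> * ennreal (Phi (t - \<mu>))"
      using em[of "{..t}"] by (simp add: N.emeasure_eq_measure std_normal.emeasure_eq_measure cdf_def)
    also have "\<dots> = ennreal ((1 - \<epsilon>) * Phi t + \<epsilon> * Phi (t - \<mu>))"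
      using assms Phi_pos[of t] Phi_pos[of "t - \<mu>"]
      by (simp add: ennreal_mult[symmetric] ennreal_plus[symmetric] del: ennreal_plus)
    finally have "measure (normal_mixture \<epsilon> \<mu>) {..t} = (1 - \<epsilon>) * Phi t + \<epsilon> * Phi (t - \<mu>)"
      using assms Phi_pos[of t] Phi_pos[of "t - \<mu>"] by (subst (asm) ennreal_inj) auto
    then show "cdf (normal_mixture \<epsilon> \<mu>) t = mixture_cdf \<epsilon> \<mu> t"
      by (simp add: cdf_def mixture_cdf_def window_def algebra_simps)
  qed
qed

text \<open>
  For \<open>0 < u < 1\<close> the event \<open>F(X) \<le> u\<close> is \<open>X \<le> x\<^sub>0\<close> with \<open>F(x\<^sub>0) = u\<close>, by continuity and strict
  monotonicity of \<open>F\<close>.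
\<close>

lemma distr_mixture_cdf:
  assumes "0 \<le> \<epsilon>" "\<epsilon> < 1"
  shows "distr (normal_mixture \<epsilon> \<mu>) (uniform_measure lborel {0<..<1}) (mixture_cdf \<epsilon> \<mu>)
    = uniform_measure lborel {0<..<1}"
proof -
  let ?N = "normal_mixture \<epsilon> \<mu>" and ?U = "uniform_measure lborel {0<..<1::real}" and ?F = "mixture_cdf \<epsilon> \<mu>"
  interpret N: real_distribution ?N using normal_mixture_cdf(1)[of \<epsilon> \<mu>] assms by simp
  have cdf: "cdf ?N = ?F" using normal_mixture_cdf(2)[of \<epsilon> \<mu>] assms by simp
  have setsU: "sets ?U = sets borel" by simp
  have meas: "?F \<in> borel_measurable borel"
    by (intro borel_measurable_continuous_onI) (auto simp: continuous_on_eq_continuous_within isCont_mixture_cdf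
      intro: continuous_at_imp_continuous_within)
  have measN: "?F \<in> borel_measurable ?N" using meas by simp
  have d1: "distr ?N ?U ?F = distr ?N borel ?F"
    by (rule distr_cong) (auto simp: setsU)
  interpret U: prob_space ?U by (rule prob_space_uniform)
  have rU: "real_distribution ?U"
    by unfold_locales auto
  have rD: "real_distribution (distr ?N borel ?F)"
    using measN by simp
  have F01: "0 < ?F t" "?F t < 1" for t
    using mixture_cdf_strict_mono[OF assms, of "t - 1" t \<mu>] mixture_cdf_strict_mono[OF assms, of t "t + 1" \<mu>]
      N.cdf_nonneg[of "t - 1"] N.cdf_bounded_prob[of "t + 1"] unfolding cdf by auto
  have "cdf (distr ?N borel ?F) u = cdf ?U u" for u
  proof -
    have D: "cdf (distr ?N borel ?F) u = measure ?N {x. ?F x \<le> u}"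
      unfolding cdf_def using measN by (subst measure_distr) (auto simp: vimage_def)
    have U: "cdf ?U u = measure lborel ({0<..<1} \<inter> {..u})"
      unfolding cdf_def by (subst measure_uniform_measure) auto
    consider "u \<le> 0" | "0 < u" "u < 1" | "1 \<le> u" by linarith
    then show ?thesis
    proof cases
      case 1
      have e: "{x. ?F x \<le> u} = {}" "{0<..<1} \<inter> {..u} = {}"
        using F01(1) 1 by (auto simp: not_le intro: le_less_trans)
      show ?thesis unfolding D U e by simp
    next
      case 3
      have e: "{x. ?F x \<le> u} = space ?N" "{0<..<1} \<inter> {..u} = {0<..<1}"
        using F01(2) 3 by (auto intro: less_imp_le less_le_trans simp: normal_mixture_def)
      show ?thesis unfolding D U e using N.prob_space by simp
    next
      case 2
      have "\<forall>\<^sub>F x in at_bot. ?F x < u" "\<forall>\<^sub>F x in at_top. u < ?F x"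
        using order_tendstoD(2)[OF N.cdf_lim_at_bot 2(1)]
          order_tendstoD(1)[OF N.cdf_lim_at_top_prob 2(2)] unfolding cdf by simp_all
      then obtain x1 x2 where x1: "?F x1 < u" and x2: "u < ?F x2"
        using eventually_happens'[OF trivial_limit_at_bot_linorder]
          eventually_happens'[OF trivial_limit_at_top_linorder] by blast
      have less_iff: "?F x \<le> ?F y \<longleftrightarrow> x \<le> y" for x y
        using mixture_cdf_strict_mono[OF assms, of x y \<mu>] mixture_cdf_strict_mono[OF assms, of y x \<mu>]
        by (cases x y rule: linorder_cases) auto
      have "?F x1 \<le> ?F x2" using x1 x2 by simp
      then have "x1 \<le> x2" using less_iff[of x1 x2] by blast
      have "\<exists>x\<ge>x1. x \<le> x2 \<and> ?F x = u"
        by (rule IVT) (use x1 x2 \<open>x1 \<le> x2\<close> isCont_mixture_cdf in \<open>auto intro: less_imp_le\<close>)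
      then obtain x0 where x0: "?F x0 = u" by blast
      have "{x. ?F x \<le> u} = {..x0}"
        unfolding x0 [symmetric] less_iff by auto
      then have "cdf (distr ?N borel ?F) u = u"
        unfolding D using x0 fun_cong[OF cdf, of x0] by (simp add: cdf_def)
      moreover have "{0<..<1} \<inter> {..u} = {0<..u}" using 2 by auto
      then have "cdf ?U u = measure lborel {0<..u}" unfolding U by (simp only:)
      then have "cdf ?U u = u" using 2 by simp
      ultimately show ?thesis by simp
    qed
  qed
  then have "cdf (distr ?N borel ?F) = cdf ?U" by (rule ext)
  then show ?thesis unfolding d1 by (rule cdf_unique[OF rD rU])
qed

section \<open>The exceptional event\<close>

lemma ecdf_sum: "ecdf n x t = (\<Sum>i\<in>{1..n}. indicator {..t} (x i)) / real n"
proof -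
  have "(\<Sum>i\<in>{1..n}. indicator {..t} (x i) :: real) = (\<Sum>i\<in>{i \<in> {1..n}. x i \<le> t}. 1)"
    by (rule sum.mono_neutral_cong_right) (auto simp: indicator_def)
  then show ?thesis by (simp add: ecdf_def)
qed

lemma measurable_ecdf:
  assumes "\<And>i. i \<in> {1..n} \<Longrightarrow> sets (M i) = sets borel"
  shows "(\<lambda>x. ecdf n x t) \<in> borel_measurable (PiM {1..n} M)"
proof -
  have "(\<lambda>x. x i) \<in> borel_measurable (PiM {1..n} M)" if "i \<in> {1..n}" for i
    using measurable_component_singleton[OF that, of M] assms[OF that]
    by (simp cong: measurable_cong_sets)
  then have "(\<lambda>x. indicator {..t} (x i) :: real) \<in> borel_measurable (PiM {1..n} M)" if "i \<in> {1..n}" for i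
    by (rule measurable_compose[OF _ borel_measurable_indicator]) (use that in auto)
  then show ?thesis
    unfolding ecdf_sum by (intro borel_measurable_divide borel_measurable_sum borel_measurable_const)
qed

lemma ecdf_right_continuous: "(ecdf n u \<longlongrightarrow> ecdf n u t) (at_right t)"
proof -
  have "((\<lambda>s. indicator {..s} (u i)) \<longlongrightarrow> (indicator {..t} (u i) :: real)) (at_right t)" for i
  proof (rule tendsto_eventually)
    show "\<forall>\<^sub>F s in at_right t. indicator {..s} (u i) = (indicator {..t} (u i) :: real)"
    proof (cases "u i \<le> t")
      case True
      show ?thesis
        using eventually_at_right_less[of t]
        by eventually_elim (use True in \<open>simp add: indicator_def\<close>)
    next
      case False
      then have "\<forall>\<^sub>F s in at_right t. s < u i"
        by (intro order_tendstoD(2)[OF tendsto_ident_at]) simp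
      then show ?thesis
        by eventually_elim (use False in \<open>simp add: indicator_def\<close>)
    qed
  qed
  then have "((\<lambda>s. (\<Sum>i\<in>{1..n}. indicator {..s} (u i)) * inverse (real n))
      \<longlongrightarrow> (\<Sum>i\<in>{1..n}. indicator {..t} (u i)) * inverse (real n)) (at_right t)"
    by (intro tendsto_mult_right tendsto_sum)
  moreover have "ecdf n u = (\<lambda>s. (\<Sum>i\<in>{1..n}. indicator {..s} (u i)) * inverse (real n))"
    by (intro ext) (simp add: ecdf_sum divide_inverse)
  ultimately show ?thesis by simp
qed

definition std_deviation :: "nat \<Rightarrow> (nat \<Rightarrow> real) \<Rightarrow> real \<Rightarrow> real" where
  "std_deviation n u t = \<bar>sqrt n * (ecdf n u t - t)\<bar> / sqrt (t * (1 - t))"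

lemma W_plus_std_deviation:
  "W_plus n u = (SUP t \<in> {1/2 .. Phi (sqrt (2 * ln n))}. std_deviation n u t)"
  by (simp add: W_plus_def std_deviation_def)

lemma std_deviation_bdd_above:
  assumes "T < 1"
  shows "bdd_above (std_deviation n u ` {1/2..T})"
proof (rule bdd_aboveI2)
  fix t assume t: "t \<in> {1/2..T}"
  have "\<bar>ecdf n u t - t\<bar> \<le> 1"
    using ecdf_nonneg[of n u t] ecdf_le_1[of n u t] t assms by auto
  then have "\<bar>sqrt n * (ecdf n u t - t)\<bar> \<le> sqrt n * 1"
    unfolding abs_mult by (intro mult_mono) auto
  moreover have "sqrt (1 / 2 * (1 - T)) \<le> sqrt (t * (1 - t))"
    using t assms by (intro real_sqrt_le_mono mult_mono) auto
  ultimately show "std_deviation n u t \<le> sqrt n / sqrt (1 / 2 * (1 - T))"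
    unfolding std_deviation_def using assms by (intro frac_le) auto
qed

lemma half_le_Phi_sqrt_ln:
  assumes "1 \<le> n"
  shows "1 / 2 \<le> Phi (sqrt (2 * ln (real n)))"
  using std_normal.cdf_nondecreasing[of 0 "sqrt (2 * ln n)"] assms by (simp add: Phi_0)

text \<open>
  The path \<open>t \<mapsto> V\<^sub>n(t) - t\<close> is right-continuous, so the supremum may be taken over rational points together
  with the right end point, which is not a limit of larger points of the interval.  Measurability of
  the event in the assumption on \<open>a\<close> depends on this; the measure of a non-measurable
  set is \<open>0\<close> by convention and would carry no information.
\<close>

lemma W_plus_countable:
  fixes n :: nat
  defines "T \<equiv> Phi (sqrt (2 * ln n))"
  assumes "1 \<le> n"
  shows "W_plus n u = (SUP t \<in> insert T (\<rat> \<inter> {1/2..T}). std_deviation n u t)"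
proof -
  have T: "1 / 2 \<le> T" "T < 1"
    unfolding T_def by (rule half_le_Phi_sqrt_ln[OF assms(2)]) (rule Phi_less_1)
  let ?Q = "insert T (\<rat> \<inter> {1/2..T})"
  have bdd: "bdd_above (std_deviation n u ` {1/2..T})"
    by (rule std_deviation_bdd_above) fact
  have sub: "?Q \<subseteq> {1/2..T}" using T by auto
  have bddQ: "bdd_above (std_deviation n u ` ?Q)"
    by (rule bdd_above_mono[OF bdd]) (use sub in blast)
  have "(SUP t\<in>{1/2..T}. std_deviation n u t) = (SUP t\<in>?Q. std_deviation n u t)"
  proof (rule antisym)
    show "(SUP t\<in>?Q. std_deviation n u t) \<le> (SUP t\<in>{1/2..T}. std_deviation n u t)"
      using sub bdd by (intro cSUP_subset_mono) auto
    show "(SUP t\<in>{1/2..T}. std_deviation n u t) \<le> (SUP t\<in>?Q. std_deviation n u t)" (is "_ \<le> ?S")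
    proof (rule cSUP_least)
      show "{1/2..T} \<noteq> {}" using T by auto
      fix t assume t: "t \<in> {1/2..T}"
      show "std_deviation n u t \<le> ?S"
      proof (cases "t = T")
        case True
        then show ?thesis by (intro cSUP_upper bddQ) auto
      next
        case False
        with t have "t < T" by simp
        show ?thesis
        proof (rule ccontr)
          assume "\<not> ?thesis"
          moreover have "(std_deviation n u \<longlongrightarrow> std_deviation n u t) (at_right t)"
            unfolding std_deviation_def[abs_def] using t T
            by (intro tendsto_intros ecdf_right_continuous) auto
          ultimately have "\<forall>\<^sub>F s in at_right t. ?S < std_deviation n u s"
            by (intro order_tendstoD(1)[of _ "std_deviation n u t"]) auto
          moreover have "\<forall>\<^sub>F s in at_right t. s < T"
            using \<open>t < T\<close> by (intro order_tendstoD(2)[OF tendsto_ident_at])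
          ultimately have "\<forall>\<^sub>F s in at_right t. ?S < std_deviation n u s \<and> s < T"
            by (rule eventually_conj)
          then obtain b where b: "t < b" "\<And>s. t < s \<Longrightarrow> s < b \<Longrightarrow> ?S < std_deviation n u s \<and> s < T"
            unfolding eventually_at_right_field by blast
          obtain s where s: "s \<in> \<rat>" "t < s" "s < b"
            using Rats_dense_in_real[OF b(1)] by blast
          then have "std_deviation n u s \<le> ?S"
            using b(2)[of s] t by (intro cSUP_upper bddQ) auto
          with b(2)[of s] s show False by simp
        qed
      qed
    qed
  qed
  then show ?thesis by (simp add: W_plus_std_deviation T_def)
qed

lemma sets_W_plus_ge:
  assumes "1 \<le> n"
  shows "{u \<in> space (uniform_sample n). W_plus n u \<ge> a} \<in> sets (uniform_sample n)"
proof -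
  let ?T = "Phi (sqrt (2 * ln n))"
  have T: "1 / 2 \<le> ?T" "?T < 1"
    by (rule half_le_Phi_sqrt_ln[OF assms]) (rule Phi_less_1)
  have e: "(\<lambda>u. ecdf n u t) \<in> borel_measurable (uniform_sample n)" for t
    unfolding uniform_sample_def by (rule measurable_ecdf) auto
  have "(\<lambda>u. SUP t \<in> insert ?T (\<rat> \<inter> {1/2..?T}). std_deviation n u t) \<in> borel_measurable (uniform_sample n)"
  proof (rule borel_measurable_cSUP)
    show "countable (insert ?T (\<rat> \<inter> {1/2..?T}))"
      using countable_rat by auto
    show "(\<lambda>u. std_deviation n u t) \<in> borel_measurable (uniform_sample n)" for t
      unfolding std_deviation_def using e[of t] by measurable
    show "bdd_above ((\<lambda>t. std_deviation n u t) ` insert ?T (\<rat> \<inter> {1/2..?T}))" for u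
      by (rule bdd_above_mono[OF std_deviation_bdd_above[OF T(2)]]) (use T in auto)
  qed
  moreover have "W_plus n = (\<lambda>u. SUP t \<in> insert ?T (\<rat> \<inter> {1/2..?T}). std_deviation n u t)"
    by (intro ext W_plus_countable[OF assms])
  ultimately have "W_plus n \<in> borel_measurable (uniform_sample n)"
    by simp
  then show ?thesis by measurable
qed

lemma mixture_sample_uniform:
  assumes "0 \<le> \<epsilon>" "\<epsilon> < 1"
  shows "compose {1..n} (mixture_cdf \<epsilon> \<mu>) \<in> measurable (mixture_sample n \<epsilon> \<mu>) (uniform_sample n)"
    and "distr (mixture_sample n \<epsilon> \<mu>) (uniform_sample n) (compose {1..n} (mixture_cdf \<epsilon> \<mu>)) = uniform_sample n"
proof -
  interpret N: real_distribution "normal_mixture \<epsilon> \<mu>"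
    using normal_mixture_cdf(1) assms by simp
  have "mixture_cdf \<epsilon> \<mu> \<in> borel_measurable borel"
    by (intro borel_measurable_continuous_onI continuous_at_imp_continuous_on ballI isCont_mixture_cdf)
  then have meas: "mixture_cdf \<epsilon> \<mu> \<in> measurable (normal_mixture \<epsilon> \<mu>) (uniform_measure lborel {0<..<1})"
    by (simp cong: measurable_cong_sets)
  then show "compose {1..n} (mixture_cdf \<epsilon> \<mu>) \<in> measurable (mixture_sample n \<epsilon> \<mu>) (uniform_sample n)"
    unfolding mixture_sample_def uniform_sample_def compose_def
    by (intro measurable_restrict measurable_compose[OF measurable_component_singleton]) auto
  show "distr (mixture_sample n \<epsilon> \<mu>) (uniform_sample n) (compose {1..n} (mixture_cdf \<epsilon> \<mu>)) = uniform_sample n"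
    unfolding mixture_sample_def uniform_sample_def
    using meas prob_space_uniform N.prob_space_axioms
    by (subst distr_PiM_finite_prob_space') (auto simp: distr_mixture_cdf[OF assms])
qed

text \<open>
  As \<open>F\<close> is strictly increasing, an observation exceeds \<open>t\<close> if and only if its image exceeds \<open>F(t)\<close>; so the deviation of the sample at \<open>t\<close> is that of the uniform sample at \<open>F(t)\<close>.
\<close>

lemma ecdf_compose:
  assumes "0 \<le> \<epsilon>" "\<epsilon> < 1"
  shows "ecdf n (compose {1..n} (mixture_cdf \<epsilon> \<mu>) x) (mixture_cdf \<epsilon> \<mu> t) = ecdf n x t"
proof -
  have "mixture_cdf \<epsilon> \<mu> s \<le> mixture_cdf \<epsilon> \<mu> t \<longleftrightarrow> s \<le> t" for s
    using mixture_cdf_strict_mono[OF assms, of s t \<mu>] mixture_cdf_strict_mono[OF assms, of t s \<mu>]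
    by (cases s t rule: linorder_cases) auto
  then have "{i \<in> {1..n}. compose {1..n} (mixture_cdf \<epsilon> \<mu>) x i \<le> mixture_cdf \<epsilon> \<mu> t} = {i \<in> {1..n}. x i \<le> t}"
    by (auto simp: compose_def)
  then show ?thesis by (simp add: ecdf_def)
qed

text \<open>
  Hoeffding's inequality for the indicators of \<open>X\<^sub>i \<le> 0\<close>.  As \<open>\<epsilon> \<le> 1/2\<close>, the value \<open>F(0)\<close> lies between
  \<open>1/4\<close> and \<open>1/2\<close>, so the standard deviation is bounded below and \<open>a\<close> standard deviations make the
  probability at most \<open>2 exp (- a\<^sup>2/4)\<close>, independently of \<open>\<epsilon>\<close> and \<open>\<mu>\<close>.
\<close>

lemma median_deviation:
  assumes "1 \<le> n" "0 \<le> \<epsilon>" "\<epsilon> \<le> 1 / 2" "0 < \<mu>" "0 \<le> a"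
  defines "F \<equiv> mixture_cdf \<epsilon> \<mu> 0"
  shows "{x \<in> space (mixture_sample n \<epsilon> \<mu>). \<bar>sqrt n * (ecdf n x 0 - F)\<bar> > a * sqrt (F * (1 - F))}
      \<in> sets (mixture_sample n \<epsilon> \<mu>)" (is "?A \<in> _")
    and "emeasure (mixture_sample n \<epsilon> \<mu>)
      {x \<in> space (mixture_sample n \<epsilon> \<mu>). \<bar>sqrt n * (ecdf n x 0 - F)\<bar> > a * sqrt (F * (1 - F))}
      \<le> ennreal (2 * exp (- a\<^sup>2 / 4))"
proof -
  interpret N: real_distribution "normal_mixture \<epsilon> \<mu>"
    using normal_mixture_cdf(1) assms by simp
  have cdf: "cdf (normal_mixture \<epsilon> \<mu>) = mixture_cdf \<epsilon> \<mu>"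
    using normal_mixture_cdf(2) assms by simp
  let ?M = "mixture_sample n \<epsilon> \<mu>"
  interpret P: prob_space ?M
    unfolding mixture_sample_def by (rule prob_space_PiM) (rule N.prob_space_axioms)
  have comp: "(\<lambda>x. x i) \<in> borel_measurable ?M" if "i \<in> {1..n}" for i
    using measurable_component_singleton[OF that, of "\<lambda>_. normal_mixture \<epsilon> \<mu>"]
    unfolding mixture_sample_def by (simp cong: measurable_cong_sets)
  have e: "(\<lambda>x. ecdf n x 0) \<in> borel_measurable ?M"
    unfolding mixture_sample_def by (rule measurable_ecdf) auto
  show sA: "?A \<in> sets ?M" using e by measurable
  have distr_comp: "distr ?M borel (\<lambda>x. x i) = normal_mixture \<epsilon> \<mu>" if "i \<in> {1..n}" for i
  proof -
    have "distr ?M borel (\<lambda>x. x i) = distr ?M (normal_mixture \<epsilon> \<mu>) (\<lambda>x. x i)"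
      by (rule distr_cong) auto
    also have "\<dots> = normal_mixture \<epsilon> \<mu>"
      unfolding mixture_sample_def using that N.prob_space_axioms
      by (intro distr_PiM_component) auto
    finally show ?thesis .
  qed
  have ind: "P.indep_vars (\<lambda>_. borel) (\<lambda>i x. x i) {1..n}"
  proof (subst P.indep_vars_iff_distr_eq_PiM')
    show "{1..n} \<noteq> {}" using assms by simp
    show "(\<lambda>x. x i) \<in> borel_measurable ?M" if "i \<in> {1..n}" for i by (rule comp[OF that])
    have "distr ?M (PiM {1..n} (\<lambda>_. borel)) (\<lambda>x. \<lambda>i\<in>{1..n}. x i) = distr ?M ?M (\<lambda>x. x)"
      by (rule distr_cong) (auto simp: mixture_sample_def space_PiM PiE_def extensional_def
          restrict_def fun_eq_iff intro!: sets_PiM_cong)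
    also have "\<dots> = ?M" by simp
    also have "\<dots> = PiM {1..n} (\<lambda>i. distr ?M borel (\<lambda>x. x i))"
      unfolding mixture_sample_def[of n \<epsilon> \<mu>]
      by (rule PiM_cong[OF refl], rule distr_comp[unfolded mixture_sample_def, symmetric])
    finally show "distr ?M (PiM {1..n} (\<lambda>_. borel)) (\<lambda>x. \<lambda>i\<in>{1..n}. x i)
        = PiM {1..n} (\<lambda>i. distr ?M borel (\<lambda>x. x i))" .
  qed
  define X where "X i x = (indicator {..0::real} (x i) :: real)" for i :: nat and x :: "nat \<Rightarrow> real"
  have ind': "P.indep_vars (\<lambda>_. borel) X {1..n}"
    unfolding X_def[abs_def] by (rule P.indep_vars_compose2[OF ind]) auto
  have expX: "P.expectation (X i) = F" if "i \<in> {1..n}" for i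
  proof -
    have "P.expectation (X i) = (LINT y|distr ?M borel (\<lambda>x. x i). indicator {..0} y)"
      unfolding X_def using comp[OF that] by (subst integral_distr) auto
    also have "\<dots> = F"
      unfolding distr_comp[OF that] F_def cdf[symmetric] by (simp add: cdf_def)
    finally show ?thesis .
  qed
  have AE: "AE x in ?M. X i x \<in> {0..1}" for i
    by (simp add: X_def indicator_def)
  interpret B: indep_interval_bounded_random_variables ?M "{1..n}" X "\<lambda>_. 0" "\<lambda>_. 1"
    by unfold_locales (use ind' AE in simp_all)
  interpret H: Hoeffding_ineq ?M "{1..n}" X "\<lambda>_. 0" "\<lambda>_. 1" "\<Sum>i\<in>{1..n}. P.expectation (X i)"
    by unfold_locales simp_all
  have F: "1 / 4 \<le> F" "F \<le> 1 / 2"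
  proof -
    have w: "0 < window 0 \<mu>" "window 0 \<mu> \<le> 1 / 2"
      using assms window_pos[of \<mu> 0] window_le_Phi[of 0 \<mu>] by (auto simp: Phi_0)
    have "\<epsilon> * window 0 \<mu> \<le> 1 / 2 * (1 / 2)"
      using assms w by (intro mult_mono) auto
    moreover have "0 \<le> \<epsilon> * window 0 \<mu>" using assms w by simp
    ultimately show "1 / 4 \<le> F" "F \<le> 1 / 2"
      by (auto simp: F_def mixture_cdf_def Phi_0)
  qed
  define d where "d = sqrt n * (a * sqrt (F * (1 - F)))"
  have "1 / 4 * (1 / 2) \<le> F * (1 - F)" using F by (intro mult_mono) auto
  then have F8: "1 / 8 \<le> F * (1 - F)" by simp
  have d0: "0 \<le> d" using F assms by (simp add: d_def)
  have "d\<^sup>2 = n * a\<^sup>2 * (F * (1 - F))"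
    using F by (simp add: d_def power_mult_distrib)
  moreover have "n * a\<^sup>2 * (1 / 8) \<le> n * a\<^sup>2 * (F * (1 - F))"
    using F8 by (intro mult_left_mono) auto
  ultimately have d2: "a\<^sup>2 / 4 \<le> 2 * d\<^sup>2 / n"
    using assms(1) by (simp add: field_simps)
  have "?A \<subseteq> {x \<in> space ?M. \<bar>(\<Sum>i\<in>{1..n}. X i x) - (\<Sum>i\<in>{1..n}. P.expectation (X i))\<bar> \<ge> d}"
  proof safe
    fix x assume x: "\<bar>sqrt n * (ecdf n x 0 - F)\<bar> > a * sqrt (F * (1 - F))"
    have "(\<Sum>i\<in>{1..n}. X i x) - (\<Sum>i\<in>{1..n}. P.expectation (X i)) = n * (ecdf n x 0 - F)"
      using assms(1) by (simp add: expX ecdf_sum X_def right_diff_distrib)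
    also have "\<dots> = sqrt n * (sqrt n * (ecdf n x 0 - F))"
      by (simp flip: mult.assoc)
    also have "\<bar>\<dots>\<bar> = sqrt n * \<bar>sqrt n * (ecdf n x 0 - F)\<bar>"
      by (simp add: abs_mult)
    finally show "\<bar>(\<Sum>i\<in>{1..n}. X i x) - (\<Sum>i\<in>{1..n}. P.expectation (X i))\<bar> \<ge> d"
      using x unfolding d_def by (simp add: mult_left_mono)
  qed
  then have "P.prob ?A \<le> P.prob {x \<in> space ?M. \<bar>(\<Sum>i\<in>{1..n}. X i x) - (\<Sum>i\<in>{1..n}. P.expectation (X i))\<bar> \<ge> d}"
    by (intro P.finite_measure_mono) auto
  also have "\<dots> \<le> 2 * exp (- 2 * d\<^sup>2 / (\<Sum>i\<in>{1..n}. (1 - 0)\<^sup>2))"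
    using H.Hoeffding_ineq_abs_ge[OF d0] assms(1) by simp
  also have "\<dots> \<le> 2 * exp (- a\<^sup>2 / 4)"
    using d2 by simp
  finally show "emeasure ?M ?A \<le> ennreal (2 * exp (- a\<^sup>2 / 4))"
    by (simp add: P.emeasure_eq_measure ennreal_leI)
qed

text \<open>
  The condition \<open>half\<close> puts \<open>F\<close> of the second grid point, and hence of all later ones, above \<open>1/2\<close>;
  the last grid point is at most \<open>sqrt (2 log n)\<close> and \<open>F \<le> \<Phi>\<close>.  So all of them except the first are mapped
  into the range of \<open>W\<^sub>n\<^sup>+\<close>.  The set \<open>B\<close> is arbitrary so that the estimate applies
  whether or not the event of interest is measurable.
\<close>

lemma emeasure_not_good_sample_le:
  assumes "2 \<le> n" "0 \<le> \<epsilon>" "\<epsilon> \<le> 1 / 2" "0 < \<mu>" "0 \<le> a"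
    and half: "\<epsilon> \<le> Phi (grid n 2) - 1 / 2"
    and bad: "\<And>x. x \<in> B \<Longrightarrow> x \<in> space (mixture_sample n \<epsilon> \<mu>) \<and> \<not> good_sample a n (mixture_cdf \<epsilon> \<mu>) x"
  shows "emeasure (mixture_sample n \<epsilon> \<mu>) B
    \<le> ennreal (2 * exp (- a\<^sup>2 / 4))
      + emeasure (uniform_sample n) {u \<in> space (uniform_sample n). W_plus n u \<ge> a}"
    (is "emeasure ?M B \<le> _ + emeasure ?U ?W")
proof -
  let ?F = "mixture_cdf \<epsilon> \<mu>"
  let ?c = "compose {1..n} ?F"
  define A where "A = {x \<in> space ?M. \<bar>sqrt n * (ecdf n x 0 - ?F 0)\<bar> > a * sqrt (?F 0 * (1 - ?F 0))}"
  have e1: "\<epsilon> < 1" "1 \<le> n" using assms by auto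
  have sW: "?W \<in> sets ?U" by (rule sets_W_plus_ge) fact
  have cm: "?c \<in> measurable ?M ?U" using mixture_sample_uniform(1) assms e1 by blast
  have sC: "?c -` ?W \<inter> space ?M \<in> sets ?M" using cm sW by (rule measurable_sets)
  have sub: "B \<subseteq> A \<union> (?c -` ?W \<inter> space ?M)"
  proof
    fix x assume "x \<in> B"
    then have x: "x \<in> space ?M" and "\<not> good_sample a n ?F x" using bad by auto
    then obtain k where k: "1 \<le> k" "real k \<le> 2 * ln n + 1"
      and dev: "\<bar>sqrt n * (ecdf n x (grid n k) - ?F (grid n k))\<bar> > a * sqrt (?F (grid n k) * (1 - ?F (grid n k)))"
      by (auto simp: good_sample_def not_le)
    show "x \<in> A \<union> (?c -` ?W \<inter> space ?M)"
    proof (cases "k = 1")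
      case True
      then show ?thesis using dev x by (simp add: A_def grid_def)
    next
      case False
      then have k2: "2 \<le> k" using k by simp
      let ?t = "grid n k" and ?T = "Phi (sqrt (2 * ln n))"
      have L: "0 < sqrt (2 * ln n)" using assms by simp
      have w: "0 < window ?t \<mu>" "window ?t \<mu> \<le> 1"
        using assms window_pos[of \<mu> ?t] window_le_Phi[of ?t \<mu>] Phi_less_1[of ?t] by auto
      have "\<epsilon> * window ?t \<mu> \<le> \<epsilon> * 1" using assms w by (intro mult_left_mono) auto
      moreover have "grid n 2 \<le> ?t"
        using k2 L by (simp add: grid_def divide_right_mono)
      then have "Phi (grid n 2) \<le> Phi ?t" by (rule std_normal.cdf_nondecreasing)
      ultimately have lower: "1 / 2 \<le> ?F ?t" using half by (simp add: mixture_cdf_def)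
      have "?t \<le> 2 * ln n / sqrt (2 * ln n)"
        unfolding grid_def using k L by (intro divide_right_mono) auto
      also have "\<dots> = sqrt (2 * ln n)" using assms by (simp add: real_div_sqrt)
      finally have "Phi ?t \<le> ?T" by (rule std_normal.cdf_nondecreasing)
      moreover have "0 \<le> \<epsilon> * window ?t \<mu>" using assms w by simp
      ultimately have upper: "?F ?t \<le> ?T" by (simp add: mixture_cdf_def)
      have "?F ?t < 1" using upper Phi_less_1[of "sqrt (2 * ln n)"] by simp
      then have pos: "0 < sqrt (?F ?t * (1 - ?F ?t))" using lower by simp
      have "a < std_deviation n (?c x) (?F ?t)"
        unfolding std_deviation_def ecdf_compose[OF assms(2) e1(1)]
        using dev pos by (simp add: pos_less_divide_eq)
      also have "\<dots> \<le> W_plus n (?c x)"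
        unfolding W_plus_std_deviation using lower upper Phi_less_1
        by (intro cSUP_upper std_deviation_bdd_above) auto
      finally have "a \<le> W_plus n (?c x)" by simp
      moreover have "?c x \<in> space ?U" using measurable_space[OF cm x] .
      ultimately show ?thesis using x by (intro UnI2 IntI vimageI2 CollectI conjI)
    qed
  qed
  have A: "A \<in> sets ?M" "emeasure ?M A \<le> ennreal (2 * exp (- a\<^sup>2 / 4))"
    unfolding A_def by (rule median_deviation[OF e1(2) assms(2-5)])+
  have "emeasure ?M B \<le> emeasure ?M (A \<union> (?c -` ?W \<inter> space ?M))"
    by (rule emeasure_mono[OF sub sets.Un[OF A(1) sC]])
  also have "\<dots> \<le> emeasure ?M A + emeasure ?M (?c -` ?W \<inter> space ?M)"
    by (rule emeasure_subadditive[OF A(1) sC])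
  also have "emeasure ?M (?c -` ?W \<inter> space ?M) = emeasure (distr ?M ?U ?c) ?W"
    by (rule emeasure_distr[OF cm sW, symmetric])
  also have "\<dots> = emeasure ?U ?W"
    using mixture_sample_uniform(2)[OF assms(2) e1(1)] by simp
  finally show ?thesis using A(2) by (meson add_right_mono order_trans)
qed

text \<open>
  The excess \<open>\<Phi>(t\<^sub>2) - 1/2\<close> is of order \<open>1 / sqrt (log n)\<close>, whereas \<open>\<epsilon>\<^sub>n \<le> 1 / sqrt n\<close>.
\<close>

lemma eps_seq_eventually_le:
  "\<forall>\<^sub>F n in sequentially. \<forall>\<beta>>1/2. eps_seq \<beta> n \<le> 1 / 2 \<and> eps_seq \<beta> n \<le> Phi (grid n 2) - 1 / 2"
proof -
  have "\<forall>\<^sub>F n in sequentially. real n powr (- (1 / 2)) \<le> 1 / 2"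
    "\<forall>\<^sub>F n in sequentially. 1 \<le> sqrt (2 * ln (real n))"
    by real_asymp+
  moreover define K where "K = std_normal_density 1"
  have "0 < K" by (simp add: K_def std_normal_density_pos)
  then have "\<forall>\<^sub>F n in sequentially. real n powr (- (1 / 2)) \<le> 1 / sqrt (2 * ln (real n)) * K"
    by real_asymp
  ultimately show ?thesis
    using eventually_ge_at_top[of 2]
  proof eventually_elim
    case (elim n)
    show ?case
    proof (intro allI impI)
      fix \<beta> :: real assume "1 / 2 < \<beta>"
      then have \<beta>: "eps_seq \<beta> n \<le> real n powr (- (1 / 2))"
        unfolding eps_seq_def using elim by (intro powr_mono) auto
      let ?t = "grid n 2"
      have t: "?t = 1 / sqrt (2 * ln n)" by (simp add: grid_def)
      have t01: "0 \<le> ?t" "?t \<le> 1" using elim by (auto simp: t)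
      have "?t * K \<le> ?t * std_normal_density ?t"
        unfolding K_def using t01 by (intro mult_left_mono std_normal_density_antimono) auto
      also have "\<dots> \<le> Phi ?t - 1 / 2"
        using Phi_diff_bounds(2)[of 0 ?t] t01 by (simp add: Phi_0)
      finally show "eps_seq \<beta> n \<le> 1 / 2 \<and> eps_seq \<beta> n \<le> Phi ?t - 1 / 2"
        using elim \<beta> by (simp add: t)
    qed
  qed
qed

section \<open>Detectability\<close>

text \<open>
  With \<open>t = x M\<close> the logarithmic ratio of signal to null noise, in units of \<open>log n\<close>, is
  \<open>(1 + x\<^sup>2)/2 - \<beta> - (x - sqrt r)\<^sup>2\<close>.  It is maximal at \<open>x = 2 sqrt r\<close>, and the grid allows \<open>x \<le> 1\<close>.
\<close>

definition best_level :: "real \<Rightarrow> real" where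
  "best_level r = min (2 * sqrt r) 1"

text \<open>
  For \<open>2 sqrt r \<le> 1\<close> the first exponent condition reads \<open>r > \<beta> - 1/2\<close>; such \<open>r\<close> are in the region only if
  \<open>\<beta> \<le> 3/4\<close>, where this is the definition of \<open>\<rho>\<^sup>*\<close>; the
  second, \<open>\<beta> + r < 1\<close>, holds because \<open>\<beta> \<le> 3/4\<close> and \<open>r \<le> 1/4\<close> are not both equalities.  Otherwise \<open>x = 1\<close>, and both conditions become
  \<open>sqrt r > 1 - sqrt (1 - \<beta>)\<close>; for \<open>\<beta> \<le> 3/4\<close> this follows from \<open>sqrt r > 1/2\<close>.
\<close>

lemma detectable_margins:
  assumes "(\<beta>, r) \<in> detectable_region"
  shows "0 < sqrt r" "0 < best_level r - sqrt r"
    and "\<beta> + (best_level r - sqrt r)\<^sup>2 < (1 + (best_level r)\<^sup>2) / 2"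
    and "\<beta> + (best_level r - sqrt r)\<^sup>2 < 1"
proof -
  have h: "rho_star \<beta> < r" "r < 1" "1 / 2 < \<beta>" "\<beta> < 1"
    using assms by (auto simp: detectable_region_def)
  have "0 \<le> rho_star \<beta>" using h by (auto simp: rho_star_def)
  then have r: "0 < r" using h by simp
  define s where "s = sqrt r"
  have s: "0 < s" "s < 1" "r = s\<^sup>2" using r h by (auto simp: s_def)
  from s(1,2) show "0 < sqrt r" "0 < best_level r - sqrt r"
    by (auto simp: best_level_def s_def)
  have "\<beta> + (best_level r - s)\<^sup>2 < (1 + (best_level r)\<^sup>2) / 2 \<and> \<beta> + (best_level r - s)\<^sup>2 < 1"
  proof (cases "2 * s \<le> 1")
    case True
    then have b: "best_level r = 2 * s" by (simp add: best_level_def s_def)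
    have "s\<^sup>2 \<le> (1 / 2)\<^sup>2" using True s by (intro power_mono) auto
    then have s4: "s\<^sup>2 \<le> 1 / 4" by (simp add: power2_eq_square)
    have b34: "\<beta> \<le> 3 / 4"
    proof (rule ccontr)
      assume n: "\<not> \<beta> \<le> 3 / 4"
      then have "sqrt (1 - \<beta>) < sqrt ((1 / 2)\<^sup>2)"
        by (intro real_sqrt_less_mono) (simp add: power2_eq_square)
      then have "1 / 2 < 1 - sqrt (1 - \<beta>)" by simp
      then have "(1 / 2)\<^sup>2 < (1 - sqrt (1 - \<beta>))\<^sup>2" by (intro power_strict_mono) auto
      then have "1 / 4 < rho_star \<beta>" using n by (simp add: rho_star_def power2_eq_square)
      then show False using h s4 s by simp
    qed
    then have "\<beta> - 1 / 2 < s\<^sup>2" using h(1) s(3) by (simp add: rho_star_def)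
    have sq: "(2 * s - s)\<^sup>2 = s\<^sup>2" "(2 * s)\<^sup>2 = 4 * s\<^sup>2"
      by (simp_all add: power_mult_distrib)
    have "\<beta> + s\<^sup>2 < (1 + 4 * s\<^sup>2) / 2" using \<open>\<beta> - 1 / 2 < s\<^sup>2\<close> by simp
    moreover have "\<beta> + s\<^sup>2 < 1" using \<open>\<beta> - 1 / 2 < s\<^sup>2\<close> b34 s4 by linarith
    ultimately show ?thesis unfolding b sq by (rule conjI)
  next
    case False
    then have b: "best_level r = 1" by (simp add: best_level_def s_def)
    have "1 - sqrt (1 - \<beta>) < s"
    proof (cases "\<beta> \<le> 3 / 4")
      case True
      then have "sqrt ((1 / 2)\<^sup>2) \<le> sqrt (1 - \<beta>)"
        by (intro real_sqrt_le_mono) (simp add: power2_eq_square)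
      then show ?thesis using False by simp
    next
      case n: False
      then have "(1 - sqrt (1 - \<beta>))\<^sup>2 < s\<^sup>2" using h s by (simp add: rho_star_def)
      then show ?thesis using s by (simp add: power2_less_imp_less)
    qed
    then have "(1 - s)\<^sup>2 < (sqrt (1 - \<beta>))\<^sup>2" using s by (intro power_strict_mono) auto
    then show ?thesis unfolding b using h by simp
  qed
  then show "\<beta> + (best_level r - sqrt r)\<^sup>2 < (1 + (best_level r)\<^sup>2) / 2"
    "\<beta> + (best_level r - sqrt r)\<^sup>2 < 1"
    by (auto simp: s_def)
qed

text \<open>
  The detectable region is bounded, so \<open>\<Omega>\<close> is compact, and the smallest of the four continuous
  margins attains a positive minimum on it.
\<close>

lemma uniform_margins:
  assumes "closed \<Omega>" "\<Omega> \<subseteq> detectable_region"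
  obtains c where "0 < c" "\<And>\<beta> r. (\<beta>, r) \<in> \<Omega> \<Longrightarrow>
    c \<le> sqrt r \<and> c \<le> best_level r - sqrt r \<and>
    c + \<beta> + (best_level r - sqrt r)\<^sup>2 \<le> (1 + (best_level r)\<^sup>2) / 2 \<and>
    c + \<beta> + (best_level r - sqrt r)\<^sup>2 \<le> 1"
proof (cases "\<Omega> = {}")
  case True
  then show ?thesis using that[of 1] by simp
next
  case False
  have "detectable_region \<subseteq> {0..1} \<times> {0..1}"
  proof
    fix p assume "p \<in> detectable_region"
    then obtain \<beta> r where p: "p = (\<beta>, r)" "(\<beta>, r) \<in> detectable_region" by (cases p) auto
    then have "0 < r" using detectable_margins(1) by force
    then show "p \<in> {0..1} \<times> {0..1}" using p by (auto simp: detectable_region_def)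
  qed
  moreover have "bounded ({0..1::real} \<times> {0..1::real})"
    by (intro bounded_Times bounded_closed_interval)
  ultimately have "bounded \<Omega>"
    using assms(2) by (meson bounded_subset)
  then have "compact \<Omega>" using assms(1) by (simp add: compact_eq_bounded_closed)
  define g where "g p = min (min (sqrt (snd p)) (best_level (snd p) - sqrt (snd p)))
      (min ((1 + (best_level (snd p))\<^sup>2) / 2 - fst p - (best_level (snd p) - sqrt (snd p))\<^sup>2)
        (1 - fst p - (best_level (snd p) - sqrt (snd p))\<^sup>2))" for p :: "real \<times> real"
  have "continuous_on \<Omega> g"
    unfolding g_def best_level_def by (intro continuous_intros) auto
  then obtain p where p: "p \<in> \<Omega>" "\<And>q. q \<in> \<Omega> \<Longrightarrow> g p \<le> g q"
    using continuous_attains_inf[OF \<open>compact \<Omega>\<close> False, of g] by blast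
  have "(fst p, snd p) \<in> detectable_region" using p(1) assms(2) by auto
  from detectable_margins[OF this] have "0 < g p"
    unfolding g_def min_less_iff_conj by (intro conjI) linarith+
  then show ?thesis
  proof (rule that)
    fix \<beta> r assume "(\<beta>, r) \<in> \<Omega>"
    from p(2)[OF this, unfolded g_def[of "(\<beta>, r)"] min.bounded_iff fst_conv snd_conv]
    show "g p \<le> sqrt r \<and> g p \<le> best_level r - sqrt r \<and>
      g p + \<beta> + (best_level r - sqrt r)\<^sup>2 \<le> (1 + (best_level r)\<^sup>2) / 2 \<and>
      g p + \<beta> + (best_level r - sqrt r)\<^sup>2 \<le> 1"
      by (intro conjI) linarith+
  qed
qed

section \<open>Consistency of the estimator\<close>

theorem theorem6p1:
  fixes \<Omega> :: "(real \<times> real) set" and a :: "nat \<Rightarrow> real"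
  assumes "closed \<Omega>"
    and "\<Omega> \<subseteq> interior detectable_region"
    and "(\<lambda>n. a n / sqrt (2 * ln (ln (real n)))) \<longlonglongrightarrow> 1"
    and "(\<lambda>n. emeasure (uniform_sample n)
               {u \<in> space (uniform_sample n). W_plus n u \<ge> a n}) \<longlonglongrightarrow> 0"
  shows "\<forall>\<delta>>0. (\<lambda>n. SUP (\<beta>, r) \<in> \<Omega>.
           emeasure (mixture_sample n (eps_seq \<beta> n) (mu_seq r n))
             {x \<in> space (mixture_sample n (eps_seq \<beta> n) (mu_seq r n)).
                \<bar>eps_star (a n) n x / eps_seq \<beta> n - 1\<bar> \<ge> \<delta>}) \<longlonglongrightarrow> 0"
proof (intro allI impI)
  fix \<delta> :: real assume \<delta>: "0 < \<delta>"
  have sub: "\<Omega> \<subseteq> detectable_region" using assms(2) interior_subset by blast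
  obtain c where c: "0 < c" "\<And>\<beta> r. (\<beta>, r) \<in> \<Omega> \<Longrightarrow>
      c \<le> sqrt r \<and> c \<le> best_level r - sqrt r \<and>
      c + \<beta> + (best_level r - sqrt r)\<^sup>2 \<le> (1 + (best_level r)\<^sup>2) / 2 \<and>
      c + \<beta> + (best_level r - sqrt r)\<^sup>2 \<le> 1"
    using uniform_margins[OF assms(1) sub] by metis
  define bnd where "bnd n = ennreal (2 * exp (- (a n)\<^sup>2 / 4))
      + emeasure (uniform_sample n) {u \<in> space (uniform_sample n). W_plus n u \<ge> a n}" for n
  have a_top: "filterlim a at_top sequentially"
  proof -
    have s: "filterlim (\<lambda>n. sqrt (2 * ln (ln (real n)))) at_top sequentially"
      by real_asymp
    have "filterlim (\<lambda>n. a n / sqrt (2 * ln (ln (real n))) * sqrt (2 * ln (ln (real n)))) at_top sequentially"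
      by (rule filterlim_tendsto_pos_mult_at_top[OF assms(3) _ s]) simp
    moreover have "\<forall>\<^sub>F n in sequentially. 0 < sqrt (2 * ln (ln (real n)))"
      by real_asymp
    then have "\<forall>\<^sub>F n in sequentially. a n / sqrt (2 * ln (ln (real n))) * sqrt (2 * ln (ln (real n))) = a n"
      by eventually_elim simp
    from filterlim_cong[OF refl refl this] calculation show ?thesis by blast
  qed
  have "((\<lambda>y::real. 2 * exp (- y\<^sup>2 / 4)) \<longlongrightarrow> 0) at_top" by real_asymp
  from filterlim_compose[OF this a_top]
  have "(\<lambda>n. ennreal (2 * exp (- (a n)\<^sup>2 / 4))) \<longlonglongrightarrow> ennreal 0"
    by (intro tendsto_ennrealI)
  from tendsto_add[OF this assms(4)] have bnd0: "bnd \<longlonglongrightarrow> 0"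
    unfolding bnd_def by simp
  have "\<forall>\<^sub>F n in sequentially. 0 \<le> a n"
    using a_top by (auto simp: filterlim_at_top)
  then have "\<forall>\<^sub>F n in sequentially. (SUP (\<beta>, r) \<in> \<Omega>.
           emeasure (mixture_sample n (eps_seq \<beta> n) (mu_seq r n))
             {x \<in> space (mixture_sample n (eps_seq \<beta> n) (mu_seq r n)).
                \<bar>eps_star (a n) n x / eps_seq \<beta> n - 1\<bar> \<ge> \<delta>}) \<le> bnd n"
    using eps_star_eventually_close[OF assms(3) c(1) \<delta>] eps_seq_eventually_le
      eventually_ge_at_top[of 2]
  proof eventually_elim
    case (elim n)
    show ?case
    proof (rule SUP_least)
      fix p assume "p \<in> \<Omega>"
      then obtain \<beta> r where p: "p = (\<beta>, r)" "(\<beta>, r) \<in> \<Omega>" by (cases p) auto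
      then have dr: "1 / 2 < \<beta>" using sub by (auto simp: detectable_region_def)
      have L: "0 < sqrt (2 * ln n)" using elim by simp
      have cr: "c \<le> sqrt r" using c(2)[OF p(2)] by simp
      have \<mu>: "mu_seq r n = sqrt r * sqrt (2 * ln n)"
        by (simp add: mu_seq_def real_sqrt_mult mult_ac)
      have "0 < sqrt r" using cr c(1) by linarith
      then have \<mu>0: "0 < mu_seq r n" unfolding \<mu> using L by (rule mult_pos_pos)
      have \<epsilon>: "0 \<le> eps_seq \<beta> n" "eps_seq \<beta> n \<le> 1 / 2" "eps_seq \<beta> n \<le> Phi (grid n 2) - 1 / 2"
        using elim dr by (auto simp: eps_seq_def)
      let ?M = "mixture_sample n (eps_seq \<beta> n) (mu_seq r n)"
      let ?F = "mixture_cdf (eps_seq \<beta> n) (mu_seq r n)"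
      have close: "\<bar>eps_star (a n) n x / eps_seq \<beta> n - 1\<bar> < \<delta>" if "good_sample (a n) n ?F x" for x
      proof (rule elim(2)[rule_format, of "sqrt r" "best_level r" \<beta> x])
        show "good_sample (a n) n (mixture_cdf (eps_seq \<beta> n) (sqrt r * sqrt (2 * ln n))) x"
          using that unfolding \<mu> .
      qed (use c(2)[OF p(2)] dr in \<open>simp_all add: best_level_def\<close>)
      show "(case p of (\<beta>, r) \<Rightarrow> emeasure (mixture_sample n (eps_seq \<beta> n) (mu_seq r n))
             {x \<in> space (mixture_sample n (eps_seq \<beta> n) (mu_seq r n)).
                \<bar>eps_star (a n) n x / eps_seq \<beta> n - 1\<bar> \<ge> \<delta>}) \<le> bnd n"
        unfolding p(1) prod.case bnd_def
      proof (rule emeasure_not_good_sample_le[OF _ \<epsilon>(1,2) \<mu>0 _ \<epsilon>(3)])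
        fix x assume "x \<in> {x \<in> space ?M. \<bar>eps_star (a n) n x / eps_seq \<beta> n - 1\<bar> \<ge> \<delta>}"
        then show "x \<in> space ?M \<and> \<not> good_sample (a n) n ?F x"
          using close[of x] by auto
      qed (use elim in auto)
    qed
  qed
  then show "(\<lambda>n. SUP (\<beta>, r) \<in> \<Omega>.
           emeasure (mixture_sample n (eps_seq \<beta> n) (mu_seq r n))
             {x \<in> space (mixture_sample n (eps_seq \<beta> n) (mu_seq r n)).
                \<bar>eps_star (a n) n x / eps_seq \<beta> n - 1\<bar> \<ge> \<delta>}) \<longlonglongrightarrow> 0"
    by (rule tendsto_sandwich[OF always_eventually _ tendsto_const bnd0, rotated]) simp
qed

end
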